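(* For every integer $m\ge2$, there exist at least $m+1$ pairwise inequivalent primitive formally dual pairs in $\mathbb{Z}_2\times\mathbb{Z}_4^{2m}$.
   Context: For a subset $A$ of a finite abelian group $G$ (written multiplicatively), $\nu_A(y)=|\{(a_1,a_2)\in A\times A\mid y=a_1a_2^{-1}\}|$ and $\chi(A)=\sum_{a\in A}\chi(a)$ for a character $\chi$. Subsets $S,T$ of $G$ (nonempty) form a formally dual pair in $G$ if, for some group isomorphism $\Delta:G\to\widehat G$, $\Delta(y)=\chi_y$, one has $|\chi_y(S)|^2=\frac{|S|^2}{|T|}\nu_T(y)$ for each $y\in G$. A subset of $G$ is primitive if it is not contained in a coset of a proper subgroup of $G$ and is not a union of cosets of a nontrivial subgroup of $G$; a formally dual pair is primitive if both subsets are primitive. A formally dual set is a member of a formally dual pair. Two formally dual sets $S,S'$ in $G$ are equivalent if there exist $g\in G$ and $\phi\in\mathrm{Aut}(G)$ with $S'=g\phi(S)$. Two formally dual pairs $S,T$ and $S',T'$ in $G$ are equivalent if one of $S$ and $T$ is equivalent to one of $S'$ and $T'$; otherwise they are inequivalent. *)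

theory Defs
  imports Complex_Main "HOL-Algebra.Algebra"
begin

definition complex_mult_group :: "complex monoid" where
  "complex_mult_group = \<lparr>carrier = - {0}, monoid.mult = (*), one = 1\<rparr>"

(* Characters are taken extensional (undefined off the carrier of G), so that they are
   determined by their values on G and the dual group has the correct cardinality. *)
definition characters :: "('a, 'b) monoid_scheme \<Rightarrow> ('a \<Rightarrow> complex) set" where
  "characters G = hom G complex_mult_group \<inter> extensional (carrier G)"

definition dual_group :: "('a, 'b) monoid_scheme \<Rightarrow> ('a \<Rightarrow> complex) monoid" where
  "dual_group G = \<lparr>carrier = characters G,
                   monoid.mult = (\<lambda>\<chi> \<psi>. \<lambda>x\<in>carrier G. \<chi> x * \<psi> x),
                   one = (\<lambda>x\<in>carrier G. 1)\<rparr>"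

definition nu :: "('a, 'b) monoid_scheme \<Rightarrow> 'a set \<Rightarrow> 'a \<Rightarrow> nat" where
  "nu G A y = card {(a1, a2) \<in> A \<times> A. y = a1 \<otimes>\<^bsub>G\<^esub> inv\<^bsub>G\<^esub> a2}"

definition char_sum :: "('a \<Rightarrow> complex) \<Rightarrow> 'a set \<Rightarrow> complex" where
  "char_sum \<chi> A = (\<Sum>a\<in>A. \<chi> a)"

definition formally_dual_pair :: "('a, 'b) monoid_scheme \<Rightarrow> 'a set \<Rightarrow> 'a set \<Rightarrow> bool" where
  "formally_dual_pair G S T \<longleftrightarrow>
     S \<subseteq> carrier G \<and> S \<noteq> {} \<and> T \<subseteq> carrier G \<and> T \<noteq> {} \<and>
     (\<exists>\<Delta> \<in> iso G (dual_group G). \<forall>y \<in> carrier G.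
        (cmod (char_sum (\<Delta> y) S))\<^sup>2 = (real (card S))\<^sup>2 / real (card T) * real (nu G T y))"

definition primitive_subset :: "('a, 'b) monoid_scheme \<Rightarrow> 'a set \<Rightarrow> bool" where
  "primitive_subset G A \<longleftrightarrow>
     A \<subseteq> carrier G \<and>
     \<not> (\<exists>H. subgroup H G \<and> H \<noteq> carrier G \<and> (\<exists>C \<in> rcosets\<^bsub>G\<^esub> H. A \<subseteq> C)) \<and>
     \<not> (\<exists>H. subgroup H G \<and> H \<noteq> {\<one>\<^bsub>G\<^esub>} \<and> (\<exists>\<C> \<subseteq> rcosets\<^bsub>G\<^esub> H. A = \<Union>\<C>))"

definition primitive_formally_dual_pair ::
  "('a, 'b) monoid_scheme \<Rightarrow> 'a set \<Rightarrow> 'a set \<Rightarrow> bool" where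
  "primitive_formally_dual_pair G S T \<longleftrightarrow>
     formally_dual_pair G S T \<and> primitive_subset G S \<and> primitive_subset G T"

definition equivalent_sets :: "('a, 'b) monoid_scheme \<Rightarrow> 'a set \<Rightarrow> 'a set \<Rightarrow> bool" where
  "equivalent_sets G S S' \<longleftrightarrow>
     (\<exists>g \<in> carrier G. \<exists>\<phi> \<in> auto G. S' = g <#\<^bsub>G\<^esub> (\<phi> ` S))"

(* This relation need not be transitive, so "pairwise inequivalent" below is a condition on
   every two members of a family and not a count of equivalence classes. *)
definition equivalent_pairs ::
  "('a, 'b) monoid_scheme \<Rightarrow> 'a set \<times> 'a set \<Rightarrow> 'a set \<times> 'a set \<Rightarrow> bool" where
  "equivalent_pairs G = (\<lambda>(S, T) (S', T').
     equivalent_sets G S S' \<or> equivalent_sets G S T' \<or>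
     equivalent_sets G T S' \<or> equivalent_sets G T T')"

definition Z2_Z4_power :: "nat \<Rightarrow> (int \<times> (nat \<Rightarrow> int)) monoid" where
  "Z2_Z4_power n =
     integer_mod_group 2 \<times>\<times> product_group {..<n} (\<lambda>_. integer_mod_group 4)"

lemma comm_group_dual_group:
  assumes "group G"
  shows "comm_group (dual_group G)"
proof -
  interpret G: group G by fact
  show ?thesis
  proof (rule comm_groupI)
    fix \<chi> assume c: "\<chi> \<in> carrier (dual_group G)"
    define \<psi> where "\<psi> = (\<lambda>x\<in>carrier G. inverse (\<chi> x))"
    have nz: "\<chi> x \<noteq> 0" if "x \<in> carrier G" for x
      using c that by (auto simp: dual_group_def characters_def hom_def complex_mult_group_def)
    have mult: "\<chi> (x \<otimes>\<^bsub>G\<^esub> y) = \<chi> x * \<chi> y" if "x \<in> carrier G" "y \<in> carrier G" for x y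
      using c that by (simp add: dual_group_def characters_def hom_def complex_mult_group_def)
    have "\<psi> \<in> carrier (dual_group G)"
      by (simp add: dual_group_def characters_def hom_def complex_mult_group_def \<psi>_def nz mult)
    moreover have "\<psi> \<otimes>\<^bsub>dual_group G\<^esub> \<chi> = \<one>\<^bsub>dual_group G\<^esub>"
      by (simp add: dual_group_def \<psi>_def nz cong: restrict_cong)
    ultimately show "\<exists>\<psi>\<in>carrier (dual_group G). \<psi> \<otimes>\<^bsub>dual_group G\<^esub> \<chi> = \<one>\<^bsub>dual_group G\<^esub>"
      by blast
  next
    show "\<one>\<^bsub>dual_group G\<^esub> \<in> carrier (dual_group G)"
      by (auto simp: dual_group_def characters_def hom_def complex_mult_group_def)
  next
    fix \<chi> \<psi> assume "\<chi> \<in> carrier (dual_group G)" "\<psi> \<in> carrier (dual_group G)"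
    then show "\<chi> \<otimes>\<^bsub>dual_group G\<^esub> \<psi> \<in> carrier (dual_group G)"
      by (auto simp: dual_group_def characters_def hom_def complex_mult_group_def Pi_def)
  next
    fix \<chi> assume "\<chi> \<in> carrier (dual_group G)"
    then show "\<one>\<^bsub>dual_group G\<^esub> \<otimes>\<^bsub>dual_group G\<^esub> \<chi> = \<chi>"
      by (auto simp: dual_group_def characters_def extensional_def restrict_def)
  qed (simp_all add: dual_group_def restrict_def fun_eq_iff mult_ac)
qed

lemma comm_group_Z2_Z4_power: "comm_group (Z2_Z4_power n)"
proof -
  have "group (Z2_Z4_power n)"
    unfolding Z2_Z4_power_def by (intro DirProd_group) simp_all
  then show ?thesis
  proof (rule group.group_comm_groupI)
    fix x y
    show "x \<otimes>\<^bsub>Z2_Z4_power n\<^esub> y = y \<otimes>\<^bsub>Z2_Z4_power n\<^esub> x"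
      by (cases x; cases y)
        (simp add: Z2_Z4_power_def integer_mod_group_def product_group_def restrict_def
          add.commute fun_eq_iff)
  qed
qed

lemma card_Z2_Z4_power: "card (carrier (Z2_Z4_power n)) = 2 * 4 ^ n"
  by (simp add: Z2_Z4_power_def carrier_integer_mod_group card_cartesian_product card_PiE)

end

theory Submission
  imports Defs
begin

text \<open>
  Identify \<open>\<int>\<^sub>4\<^sup>2\<^sup>m\<close> with the product of \<open>m\<close> copies of \<open>\<int>\<^sub>4\<^sup>2\<close> and the group with its dual by
  the standard pairing (\<open>pairing_char_iso\<close>). A block is a set of four elements \<open>d\<close> of \<open>\<int>\<^sub>4\<^sup>2\<close>,
  each with a weight \<open>g(d)\<close> in \<open>\<int>\<^sub>2\<close>, together with two sheets \<open>R\<^sub>0\<close>, \<open>R\<^sub>1\<close> of four elements of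
  \<open>\<int>\<^sub>4\<^sup>2\<close>. It is arranged that the sum of \<open>(-1) ^ (a * g(d))\<close> times \<open>\<i>\<close> to the power \<open>y \<cdot> d\<close>
  over all \<open>d\<close> has squared modulus \<open>4 M(a, y)\<close>, where \<open>M(a, y)\<close> is the number of ways to write \<open>y\<close>
  as a difference of an element of \<open>R\<^sub>c\<^sub>+\<^sub>a\<close> and an element of \<open>R\<^sub>c\<close>, for \<open>c = 0\<close> as well as for
  \<open>c = 1\<close>.

  Given one block for each \<open>i < m\<close>, let \<open>S\<close> consist of all \<open>(\<Sum>i. g\<^sub>i(x\<^sub>i), x)\<close> with every \<open>x\<^sub>i\<close> in
  the \<open>i\<close>-th block, and let \<open>T\<close> consist of all \<open>(c, x)\<close> with every \<open>x\<^sub>i\<close> in the \<open>i\<close>-th sheet over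
  \<open>c\<close>. Then \<open>|S| = 4 ^ m\<close> and \<open>|T| = 2 * 4 ^ m\<close>. Character sums of \<open>S\<close> factor over the blocks,
  and so do the difference counts of \<open>T\<close>, up to the factor 2 for the two values of \<open>c\<close>. Hence
  \<open>S\<close>, \<open>T\<close> is a formally dual pair (\<open>formally_dual_pair_dual\<close>). The blocks used
  here contain 0 and the unit vectors and are transversals modulo 2; the pair is then primitive
  as soon as one block has a nonzero weight and two distinct sheets (\<open>primitive_dual_S\<close>,
  \<open>primitive_dual_T\<close>); in the proof this is the block of index 0.

  Two pairs of this shape are told apart by the number of differences of elements of \<open>T\<close>. It is
  invariant under equivalence of \<open>T\<close>, and by formal duality it is also the number of characters
  whose sum over \<open>S\<close> is nonzero, which is invariant under equivalence of \<open>S\<close>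
  (\<open>not_equivalent_pairs\<close>). An \<open>S\<close> and a \<open>T\<close> are never equivalent, because their sizes differ.
  Three kinds of block are used, whose overlaps \<open>M(0, _)\<close>, \<open>M(1, _)\<close> have supports of sizes
  \<open>(9, 9)\<close>, \<open>(13, 13)\<close> and \<open>(13, 10)\<close>. With \<open>k\<close> blocks of the last kind and \<open>m - k\<close> of the first,
  the invariant is \<open>9 ^ (m - k) * (13 ^ k + 10 ^ k)\<close>, which increases strictly with \<open>k\<close>; this gives
  \<open>m\<close> pairs. Replacing one block of the first kind by one of the second in the case \<open>k = 1\<close> gives
  \<open>299 * 9 ^ (m - 2)\<close>, which is divisible by 13 and therefore a new value.
\<close>

section \<open>Difference counts, character sums and equivalence\<close>

lemma equivalent_sets_card:
  assumes "group G" "S \<subseteq> carrier G" "equivalent_sets G S S'"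
  shows "card S' = card S"
proof -
  interpret group G by fact
  obtain g \<phi> where g: "g \<in> carrier G" and \<phi>: "\<phi> \<in> auto G" and S': "S' = g <#\<^bsub>G\<^esub> (\<phi> ` S)"
    using assms(3) by (auto simp: equivalent_sets_def)
  have b: "inj_on \<phi> (carrier G)" "\<phi> ` carrier G = carrier G"
    using \<phi> by (auto simp: auto_def Bij_def bij_betw_def)
  have "S' = (\<lambda>s. g \<otimes>\<^bsub>G\<^esub> \<phi> s) ` S"
    unfolding S' l_coset_def by auto
  moreover have "inj_on (\<lambda>s. g \<otimes>\<^bsub>G\<^esub> \<phi> s) S"
  proof (rule inj_onI)
    fix x y assume xy: "x \<in> S" "y \<in> S" "g \<otimes>\<^bsub>G\<^esub> \<phi> x = g \<otimes>\<^bsub>G\<^esub> \<phi> y"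
    moreover from xy assms(2) b have "\<phi> x \<in> carrier G" "\<phi> y \<in> carrier G" by blast+
    ultimately have "\<phi> x = \<phi> y" using g by simp
    with xy assms(2) b(1) show "x = y" by (auto dest: inj_onD)
  qed
  ultimately show ?thesis by (simp add: card_image)
qed

lemma nu_eq_card_translate:
  assumes "group G" "A \<subseteq> carrier G" "y \<in> carrier G"
  shows "nu G A y = card {a \<in> A. y \<otimes>\<^bsub>G\<^esub> a \<in> A}"
proof -
  interpret group G by fact
  have eq: "{(a1, a2) \<in> A \<times> A. y = a1 \<otimes>\<^bsub>G\<^esub> inv\<^bsub>G\<^esub> a2}
      = (\<lambda>a. (y \<otimes>\<^bsub>G\<^esub> a, a)) ` {a \<in> A. y \<otimes>\<^bsub>G\<^esub> a \<in> A}"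
  proof (intro equalityI subsetI)
    fix p assume "p \<in> {(a1, a2) \<in> A \<times> A. y = a1 \<otimes>\<^bsub>G\<^esub> inv\<^bsub>G\<^esub> a2}"
    then obtain a1 a2 where p: "p = (a1, a2)" "a1 \<in> A" "a2 \<in> A" "y = a1 \<otimes>\<^bsub>G\<^esub> inv\<^bsub>G\<^esub> a2" by auto
    moreover from p assms(2) have "a1 \<in> carrier G" "a2 \<in> carrier G" by auto
    ultimately have "y \<otimes>\<^bsub>G\<^esub> a2 = a1" by (simp add: m_assoc)
    then show "p \<in> (\<lambda>a. (y \<otimes>\<^bsub>G\<^esub> a, a)) ` {a \<in> A. y \<otimes>\<^bsub>G\<^esub> a \<in> A}"
      using p(1-3) by (intro image_eqI[where x = a2]) auto
  next
    fix p assume "p \<in> (\<lambda>a. (y \<otimes>\<^bsub>G\<^esub> a, a)) ` {a \<in> A. y \<otimes>\<^bsub>G\<^esub> a \<in> A}"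
    then obtain a where p: "p = (y \<otimes>\<^bsub>G\<^esub> a, a)" "a \<in> A" "y \<otimes>\<^bsub>G\<^esub> a \<in> A" by auto
    moreover from p assms(2) have "a \<in> carrier G" by auto
    ultimately show "p \<in> {(a1, a2) \<in> A \<times> A. y = a1 \<otimes>\<^bsub>G\<^esub> inv\<^bsub>G\<^esub> a2}"
      using assms(3) by (auto simp: m_assoc)
  qed
  show ?thesis unfolding nu_def eq by (rule card_image) (auto simp: inj_on_def)
qed

text \<open>The size of the support of the difference count: the number of elements that are
  quotients of two elements of \<open>A\<close>.\<close>
definition diff_count :: "('a, 'b) monoid_scheme \<Rightarrow> 'a set \<Rightarrow> nat" where
  "diff_count G A = card {y \<in> carrier G. nu G A y \<noteq> 0}"

text \<open>An affine map \<open>a \<mapsto> g \<phi>(a)\<close> of a commutative group carries quotients to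
  quotients through \<open>\<phi>\<close>, so difference counts are permuted.\<close>
lemma equivalent_sets_diff_count:
  assumes "comm_group G" "T \<subseteq> carrier G" "equivalent_sets G T T'"
  shows "diff_count G T' = diff_count G T"
proof -
  interpret comm_group G by fact
  obtain g \<phi> where g: "g \<in> carrier G" and \<phi>: "\<phi> \<in> auto G" and T': "T' = g <#\<^bsub>G\<^esub> (\<phi> ` T)"
    using assms(3) by (auto simp: equivalent_sets_def)
  have b: "bij_betw \<phi> (carrier G) (carrier G)" and h: "\<phi> \<in> hom G G"
    using \<phi> by (auto simp: auto_def Bij_def)
  have inj: "inj_on \<phi> (carrier G)" and c: "\<And>x. x \<in> carrier G \<Longrightarrow> \<phi> x \<in> carrier G"
    using b by (auto simp: bij_betw_def)
  have inj_tr: "inj_on (\<lambda>s. g \<otimes>\<^bsub>G\<^esub> \<phi> s) (carrier G)"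
    using inj g c by (auto simp: inj_on_def)
  have T'2: "T' = (\<lambda>s. g \<otimes>\<^bsub>G\<^esub> \<phi> s) ` T"
    unfolding T' l_coset_def by auto
  have sub: "T' \<subseteq> carrier G" using T'2 g c assms(2) by auto
  have nu: "nu G T' (\<phi> y) = nu G T y" if y: "y \<in> carrier G" for y
  proof -
    have mem: "g \<otimes>\<^bsub>G\<^esub> \<phi> s \<in> T' \<longleftrightarrow> s \<in> T" if "s \<in> carrier G" for s
    proof
      assume "g \<otimes>\<^bsub>G\<^esub> \<phi> s \<in> T'"
      then obtain t where t: "t \<in> T" "g \<otimes>\<^bsub>G\<^esub> \<phi> s = g \<otimes>\<^bsub>G\<^esub> \<phi> t" using T'2 by auto
      with that assms(2) inj_tr have "s = t" by (auto dest: inj_onD)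
      with t show "s \<in> T" by simp
    qed (auto simp: T'2)
    have comm: "\<phi> y \<otimes>\<^bsub>G\<^esub> (g \<otimes>\<^bsub>G\<^esub> \<phi> s) = g \<otimes>\<^bsub>G\<^esub> \<phi> (y \<otimes>\<^bsub>G\<^esub> s)" if "s \<in> carrier G" for s
      using that y g c by (simp add: hom_mult[OF h] m_lcomm)
    have "\<phi> y \<otimes>\<^bsub>G\<^esub> (g \<otimes>\<^bsub>G\<^esub> \<phi> s) \<in> T' \<longleftrightarrow> y \<otimes>\<^bsub>G\<^esub> s \<in> T" if "s \<in> T" for s
      using that assms(2) y by (simp add: comm mem subset_iff)
    then have "{a \<in> T'. \<phi> y \<otimes>\<^bsub>G\<^esub> a \<in> T'} = (\<lambda>s. g \<otimes>\<^bsub>G\<^esub> \<phi> s) ` {a \<in> T. y \<otimes>\<^bsub>G\<^esub> a \<in> T}"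
      unfolding T'2 by blast
    moreover have "inj_on (\<lambda>s. g \<otimes>\<^bsub>G\<^esub> \<phi> s) {a \<in> T. y \<otimes>\<^bsub>G\<^esub> a \<in> T}"
      by (rule inj_on_subset[OF inj_tr]) (use assms(2) in auto)
    ultimately show ?thesis
      using assms(2) y c sub by (simp add: nu_eq_card_translate[OF is_group] card_image)
  qed
  have "bij_betw \<phi> {y \<in> carrier G. nu G T y \<noteq> 0} {y \<in> carrier G. nu G T' y \<noteq> 0}"
  proof (rule bij_betw_imageI)
    show "inj_on \<phi> {y \<in> carrier G. nu G T y \<noteq> 0}" by (rule inj_on_subset[OF inj]) auto
    show "\<phi> ` {y \<in> carrier G. nu G T y \<noteq> 0} = {y \<in> carrier G. nu G T' y \<noteq> 0}"
    proof (intro equalityI subsetI)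
      fix z assume z: "z \<in> {y \<in> carrier G. nu G T' y \<noteq> 0}"
      then obtain y where "y \<in> carrier G" "z = \<phi> y" using b by (auto simp: bij_betw_def)
      with z nu show "z \<in> \<phi> ` {y \<in> carrier G. nu G T y \<noteq> 0}" by auto
    qed (use c nu in auto)
  qed
  then show ?thesis unfolding diff_count_def by (rule bij_betw_same_card[symmetric])
qed

text \<open>Precomposition with \<open>\<phi>\<close> permutes the characters, and translation only multiplies a
  character sum by a nonzero number.\<close>
lemma equivalent_sets_char_count:
  assumes "group G" "S \<subseteq> carrier G" "equivalent_sets G S S'"
  shows "card {\<chi> \<in> characters G. char_sum \<chi> S' \<noteq> 0} = card {\<chi> \<in> characters G. char_sum \<chi> S \<noteq> 0}"
proof -
  interpret group G by fact
  obtain g \<phi> where g: "g \<in> carrier G" and \<phi>: "\<phi> \<in> auto G" and S': "S' = g <#\<^bsub>G\<^esub> (\<phi> ` S)"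
    using assms(3) by (auto simp: equivalent_sets_def)
  have b: "bij_betw \<phi> (carrier G) (carrier G)" and h: "\<phi> \<in> hom G G"
    using \<phi> by (auto simp: auto_def Bij_def)
  have inj: "inj_on \<phi> (carrier G)" and c: "\<And>x. x \<in> carrier G \<Longrightarrow> \<phi> x \<in> carrier G"
    using b by (auto simp: bij_betw_def)
  have inj_tr: "inj_on (\<lambda>s. g \<otimes>\<^bsub>G\<^esub> \<phi> s) (carrier G)"
    using inj g c by (auto simp: inj_on_def)
  have S'2: "S' = (\<lambda>s. g \<otimes>\<^bsub>G\<^esub> \<phi> s) ` S"
    unfolding S' l_coset_def by auto
  define \<psi> where "\<psi> = inv_into (carrier G) \<phi>"
  have \<psi>h: "\<psi> \<in> hom G G"
    using iso_set_sym[of \<phi> G] h b unfolding \<psi>_def iso_def by auto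
  have \<psi>c: "\<And>x. x \<in> carrier G \<Longrightarrow> \<psi> x \<in> carrier G" using \<psi>h by (auto simp: hom_def)
  have \<phi>\<psi>: "\<And>x. x \<in> carrier G \<Longrightarrow> \<phi> (\<psi> x) = x" "\<And>x. x \<in> carrier G \<Longrightarrow> \<psi> (\<phi> x) = x"
    using b by (auto simp: \<psi>_def bij_betw_def f_inv_into_f)
  have pull: "(\<lambda>x\<in>carrier G. \<chi> (\<theta> x)) \<in> characters G" if "\<chi> \<in> characters G" "\<theta> \<in> hom G G" for \<chi> \<theta>
    using that by (auto simp: characters_def hom_def Pi_def)
  have sum: "char_sum \<chi> S' = \<chi> g * char_sum (\<lambda>x\<in>carrier G. \<chi> (\<phi> x)) S" if "\<chi> \<in> characters G" for \<chi>
  proof -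
    have "inj_on (\<lambda>s. g \<otimes>\<^bsub>G\<^esub> \<phi> s) S"
      by (rule inj_on_subset[OF inj_tr assms(2)])
    then have "char_sum \<chi> S' = (\<Sum>s\<in>S. \<chi> (g \<otimes>\<^bsub>G\<^esub> \<phi> s))"
      unfolding char_sum_def S'2 by (simp add: sum.reindex)
    also have "\<dots> = (\<Sum>s\<in>S. \<chi> g * \<chi> (\<phi> s))"
      using assms(2) g c that
      by (intro sum.cong) (auto simp: characters_def hom_def complex_mult_group_def)
    also have "\<dots> = \<chi> g * char_sum (\<lambda>x\<in>carrier G. \<chi> (\<phi> x)) S"
      unfolding char_sum_def sum_distrib_left using assms(2) by (intro sum.cong) auto
    finally show ?thesis .
  qed
  have nz: "\<chi> g \<noteq> 0" if "\<chi> \<in> characters G" for \<chi>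
    using that g by (auto simp: characters_def hom_def complex_mult_group_def)
  have ext: "(\<lambda>x\<in>carrier G. \<chi> x) = \<chi>" if "\<chi> \<in> characters G" for \<chi>
    using that by (auto simp: characters_def extensional_restrict)
  have "bij_betw (\<lambda>\<chi>. \<lambda>x\<in>carrier G. \<chi> (\<phi> x)) {\<chi> \<in> characters G. char_sum \<chi> S' \<noteq> 0}
      {\<chi> \<in> characters G. char_sum \<chi> S \<noteq> 0}"
  proof (rule bij_betw_byWitness[where f' = "\<lambda>\<chi>. \<lambda>x\<in>carrier G. \<chi> (\<psi> x)"])
    have r1: "(\<lambda>x\<in>carrier G. (\<lambda>x\<in>carrier G. \<chi> (\<phi> x)) (\<psi> x)) = \<chi>" if "\<chi> \<in> characters G" for \<chi>
      by (subst (2) ext[OF that, symmetric]) (auto simp: fun_eq_iff \<phi>\<psi> \<psi>c)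
    have r2: "(\<lambda>x\<in>carrier G. (\<lambda>x\<in>carrier G. \<chi> (\<psi> x)) (\<phi> x)) = \<chi>" if "\<chi> \<in> characters G" for \<chi>
      by (subst (2) ext[OF that, symmetric]) (auto simp: fun_eq_iff \<phi>\<psi> c)
    show "\<forall>\<chi>\<in>{\<chi> \<in> characters G. char_sum \<chi> S' \<noteq> 0}.
        (\<lambda>x\<in>carrier G. (\<lambda>x\<in>carrier G. \<chi> (\<phi> x)) (\<psi> x)) = \<chi>"
      using r1 by blast
    show "\<forall>\<chi>\<in>{\<chi> \<in> characters G. char_sum \<chi> S \<noteq> 0}.
        (\<lambda>x\<in>carrier G. (\<lambda>x\<in>carrier G. \<chi> (\<psi> x)) (\<phi> x)) = \<chi>"
      using r2 by blast
    show "(\<lambda>\<chi>. \<lambda>x\<in>carrier G. \<chi> (\<phi> x)) ` {\<chi> \<in> characters G. char_sum \<chi> S' \<noteq> 0}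
        \<subseteq> {\<chi> \<in> characters G. char_sum \<chi> S \<noteq> 0}"
      using pull[OF _ h] sum by auto
    show "(\<lambda>\<chi>. \<lambda>x\<in>carrier G. \<chi> (\<psi> x)) ` {\<chi> \<in> characters G. char_sum \<chi> S \<noteq> 0}
        \<subseteq> {\<chi> \<in> characters G. char_sum \<chi> S' \<noteq> 0}"
      using pull[OF _ \<psi>h] sum[OF pull[OF _ \<psi>h]] nz[OF pull[OF _ \<psi>h]] r2 by auto
  qed
  then show ?thesis by (rule bij_betw_same_card)
qed

text \<open>Along the isomorphism of the pair, character sums of \<open>S\<close> that do not vanish correspond to
  quotients of elements of \<open>T\<close>.\<close>
lemma formally_dual_pair_char_count:
  assumes "formally_dual_pair G S T" "finite S" "finite T"
  shows "card {\<chi> \<in> characters G. char_sum \<chi> S \<noteq> 0} = diff_count G T"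
proof -
  obtain \<Delta> where \<Delta>: "\<Delta> \<in> iso G (dual_group G)" and
    e: "\<And>y. y \<in> carrier G \<Longrightarrow> (cmod (char_sum (\<Delta> y) S))\<^sup>2 = (real (card S))\<^sup>2 / real (card T) * real (nu G T y)"
    using assms(1) by (auto simp: formally_dual_pair_def)
  have pos: "card S \<noteq> 0" "card T \<noteq> 0" using assms by (auto simp: formally_dual_pair_def)
  have b: "bij_betw \<Delta> (carrier G) (characters G)" using \<Delta> by (auto simp: iso_def dual_group_def)
  have iff: "char_sum (\<Delta> y) S \<noteq> 0 \<longleftrightarrow> nu G T y \<noteq> 0" if "y \<in> carrier G" for y
  proof -
    have "(cmod (char_sum (\<Delta> y) S))\<^sup>2 = 0 \<longleftrightarrow> nu G T y = 0"
      unfolding e[OF that] using pos by simp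
    then show ?thesis by simp
  qed
  have "bij_betw \<Delta> {y \<in> carrier G. nu G T y \<noteq> 0} {\<chi> \<in> characters G. char_sum \<chi> S \<noteq> 0}"
  proof (rule bij_betw_subset[OF b])
    show "\<Delta> ` {y \<in> carrier G. nu G T y \<noteq> 0} = {\<chi> \<in> characters G. char_sum \<chi> S \<noteq> 0}"
    proof (intro equalityI subsetI)
      fix \<chi> assume \<chi>: "\<chi> \<in> {\<chi> \<in> characters G. char_sum \<chi> S \<noteq> 0}"
      then obtain y where "y \<in> carrier G" "\<chi> = \<Delta> y" using b by (auto simp: bij_betw_def)
      with \<chi> iff show "\<chi> \<in> \<Delta> ` {y \<in> carrier G. nu G T y \<noteq> 0}" by auto
    qed (use b iff in \<open>auto simp: bij_betw_def\<close>)
  qed auto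
  then show ?thesis unfolding diff_count_def by (rule bij_betw_same_card[symmetric])
qed

lemma not_equivalent_pairs:
  assumes G: "comm_group G" "finite (carrier G)"
    and d: "formally_dual_pair G S T" "formally_dual_pair G S' T'"
    and c: "card S \<noteq> card T'" "card T \<noteq> card S'" 
    and n: "diff_count G T \<noteq> diff_count G T'"
  shows "\<not> equivalent_pairs G (S, T) (S', T')"
proof -
  have g: "group G" using G(1) by (simp add: comm_group_def)
  have sub: "S \<subseteq> carrier G" "T \<subseteq> carrier G" "S' \<subseteq> carrier G" "T' \<subseteq> carrier G"
    using d by (auto simp: formally_dual_pair_def)
  have fin: "finite S" "finite T" "finite S'" "finite T'"
    using sub G(2) finite_subset by blast+
  have "\<not> equivalent_sets G S S'"
    using equivalent_sets_char_count[OF g sub(1), of S'] n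
      formally_dual_pair_char_count[OF d(1) fin(1,2)] formally_dual_pair_char_count[OF d(2) fin(3,4)] by auto
  moreover have "\<not> equivalent_sets G T T'"
    using equivalent_sets_diff_count[OF G(1) sub(2), of T'] n by auto
  moreover have "\<not> equivalent_sets G S T'" "\<not> equivalent_sets G T S'"
    using equivalent_sets_card[OF g sub(1), of T'] equivalent_sets_card[OF g sub(2), of S'] c by auto
  ultimately show ?thesis by (simp add: equivalent_pairs_def)
qed

text \<open>For a set containing the identity, lying in a coset means lying in the subgroup, and a
  subgroup whose cosets fill the set translates it into itself.\<close>
lemma primitive_subsetI:
  assumes "group G" "A \<subseteq> carrier G" "\<one>\<^bsub>G\<^esub> \<in> A"
    and gen: "\<And>H. subgroup H G \<Longrightarrow> A \<subseteq> H \<Longrightarrow> H = carrier G"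
    and per: "\<And>h. h \<in> carrier G \<Longrightarrow> (\<And>a. a \<in> A \<Longrightarrow> h \<otimes>\<^bsub>G\<^esub> a \<in> A) \<Longrightarrow> h = \<one>\<^bsub>G\<^esub>"
  shows "primitive_subset G A"
proof -
  interpret group G by fact
  have "H = carrier G" if H: "subgroup H G" and C: "C \<in> rcosets\<^bsub>G\<^esub> H" "A \<subseteq> C" for H C
  proof -
    have "\<one>\<^bsub>G\<^esub> \<in> C" using C assms(3) by auto
    moreover obtain c where "c \<in> carrier G" "C = H #>\<^bsub>G\<^esub> c"
      using C(1) by (auto simp: RCOSETS_def)
    ultimately have "C = H #>\<^bsub>G\<^esub> \<one>\<^bsub>G\<^esub>" using repr_independence H by metis
    also have "\<dots> = H" using H by (simp add: coset_join2 subgroup.one_closed)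
    finally have "C = H" .
    then show ?thesis using gen H C by auto
  qed
  moreover have "H = {\<one>\<^bsub>G\<^esub>}" if H: "subgroup H G" and C: "\<C> \<subseteq> rcosets\<^bsub>G\<^esub> H" "A = \<Union>\<C>" for H \<C>
  proof -
    have "h = \<one>\<^bsub>G\<^esub>" if h: "h \<in> H" for h
    proof (rule per)
      show "h \<in> carrier G" using H h by (rule subgroup.mem_carrier)
      fix a assume "a \<in> A"
      then obtain c where c: "c \<in> carrier G" "a \<in> H #>\<^bsub>G\<^esub> c" "H #>\<^bsub>G\<^esub> c \<in> \<C>"
        using C by (auto simp: RCOSETS_def)
      then obtain k where k: "k \<in> H" "a = k \<otimes>\<^bsub>G\<^esub> c" by (auto simp: r_coset_def)
      have "h \<otimes>\<^bsub>G\<^esub> a = (h \<otimes>\<^bsub>G\<^esub> k) \<otimes>\<^bsub>G\<^esub> c"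
        using H h k c by (simp add: m_assoc subgroup.mem_carrier)
      moreover have "h \<otimes>\<^bsub>G\<^esub> k \<in> H" using H h k by (simp add: subgroup.m_closed)
      ultimately have "h \<otimes>\<^bsub>G\<^esub> a \<in> H #>\<^bsub>G\<^esub> c" by (auto simp: r_coset_def)
      then show "h \<otimes>\<^bsub>G\<^esub> a \<in> A" using C c by auto
    qed
    then show ?thesis using subgroup.one_closed[OF H] by blast
  qed
  ultimately show ?thesis unfolding primitive_subset_def using assms(2) by blast
qed

section \<open>The group and its dual\<close>

lemma carrier_Z2_Z4_power:
  "carrier (Z2_Z4_power n) = {0..<2} \<times> (PiE {..<n} (\<lambda>_. {0..<4}))"
  by (simp add: Z2_Z4_power_def carrier_integer_mod_group)

lemma mult_Z2_Z4_power:
  "x \<otimes>\<^bsub>Z2_Z4_power n\<^esub> y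
     = ((fst x + fst y) mod 2, \<lambda>i\<in>{..<n}. (snd x i + snd y i) mod 4)"
  by (cases x; cases y) (simp add: Z2_Z4_power_def)

lemma one_Z2_Z4_power: "\<one>\<^bsub>Z2_Z4_power n\<^esub> = (0, \<lambda>i\<in>{..<n}. 0)"
  by (simp add: Z2_Z4_power_def)

lemma group_Z2_Z4_power: "group (Z2_Z4_power n)"
  using comm_group_Z2_Z4_power by (simp add: comm_group_def)

lemma finite_Z2_Z4_power: "finite (carrier (Z2_Z4_power n))"
  by (simp add: carrier_Z2_Z4_power finite_PiE)

text \<open>The vector in \<open>\<int>\<^sub>4\<^sup>n\<close> with entry \<open>r\<close> in position \<open>j\<close> and zeros elsewhere; coordinates
  outside \<open>{..<n}\<close> are undefined, as in the carrier of the product group.\<close>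
definition single :: "nat \<Rightarrow> nat \<Rightarrow> int \<Rightarrow> nat \<Rightarrow> int" where
  "single n j r = (\<lambda>i\<in>{..<n}. if i = j then r else 0)"

lemma single_in_PiE: "r \<in> {0..<4} \<Longrightarrow> single n j r \<in> PiE {..<n} (\<lambda>_. {0..<4})"
  by (auto simp: single_def)

lemma Z4_part_subset_subgroup:
  assumes H: "subgroup H (Z2_Z4_power n)" and e: "\<And>j. j < n \<Longrightarrow> (0, single n j 1) \<in> H"
    and x: "x \<in> PiE {..<n} (\<lambda>_. {0..<4})"
  shows "(0, x) \<in> H"
proof -
  have multiple: "(0, single n j r) \<in> H" if "j < n" "r \<in> {0..<4}" for j r
  proof -
    have "(0, single n j (int k mod 4)) \<in> H" for k
    proof (induction k)
      case 0
      have "(0, single n j (int 0 mod 4)) = \<one>\<^bsub>Z2_Z4_power n\<^esub>"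
        by (auto simp: one_Z2_Z4_power single_def fun_eq_iff)
      then show ?case using subgroup.one_closed[OF H] by (simp only:)
    next
      case (Suc k)
      have "(0, single n j (int (Suc k) mod 4))
          = (0, single n j (int k mod 4)) \<otimes>\<^bsub>Z2_Z4_power n\<^esub> (0, single n j 1)"
        by (auto simp: mult_Z2_Z4_power single_def fun_eq_iff mod_simps add.commute)
      then show ?case using subgroup.m_closed[OF H Suc e[OF that(1)]] by simp
    qed
    from this[of "nat r"] that show ?thesis by simp
  qed
  have "(0, x) \<in> H" if "x \<in> PiE {..<n} (\<lambda>_. {0..<4})" "\<And>i. k \<le> i \<Longrightarrow> i < n \<Longrightarrow> x i = 0" "k \<le> n" for k x
    using that
  proof (induction k arbitrary: x)
    case 0
    then have "(0, x) = \<one>\<^bsub>Z2_Z4_power n\<^esub>"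
      by (auto simp: one_Z2_Z4_power fun_eq_iff PiE_def extensional_def)
    then show ?case using subgroup.one_closed[OF H] by (simp only:)
  next
    case (Suc k)
    have "(0, x(k := 0)) \<in> H"
      using Suc.prems by (intro Suc.IH) (auto simp: PiE_def extensional_def Pi_def not_less_eq_eq)
    moreover have "(0, single n k (x k)) \<in> H"
      using Suc.prems by (intro multiple) (auto simp: PiE_def Pi_def)
    moreover have "(0, x) = (0, x(k := 0)) \<otimes>\<^bsub>Z2_Z4_power n\<^esub> (0, single n k (x k))"
      using Suc.prems(1) by (auto simp: mult_Z2_Z4_power single_def fun_eq_iff PiE_def extensional_def Pi_def)
    ultimately show ?case using subgroup.m_closed[OF H] by simp
  qed
  from this[of x n] x show ?thesis by simp
qed

text \<open>The unit vectors of \<open>\<int>\<^sub>4\<^sup>n\<close> together with any one element of odd first coordinate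
  generate the whole group. This serves both to identify characters and to prove primitivity.\<close>
lemma subgroup_Z2_Z4_power_eq_carrier:
  assumes H: "subgroup H (Z2_Z4_power n)" and e: "\<And>j. j < n \<Longrightarrow> (0, single n j 1) \<in> H"
    and z: "(1, z) \<in> H"
  shows "H = carrier (Z2_Z4_power n)"
proof
  show "H \<subseteq> carrier (Z2_Z4_power n)" using H by (rule subgroup.subset)
  show "carrier (Z2_Z4_power n) \<subseteq> H"
  proof
    fix p assume "p \<in> carrier (Z2_Z4_power n)"
    then obtain a x where p: "p = (a, x)" "a \<in> {0..<2}" and x: "x \<in> PiE {..<n} (\<lambda>_. {0..<4})"
      by (auto simp: carrier_Z2_Z4_power)
    from p consider "a = 0" | "a = 1" by fastforce
    then show "p \<in> H"
    proof cases
      case 1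
      then show ?thesis using Z4_part_subset_subgroup[OF H e x] p by simp
    next
      case 2
      define d where "d = (\<lambda>i\<in>{..<n}. (x i - z i) mod 4)"
      have "(0, d) \<in> H" by (rule Z4_part_subset_subgroup[OF H e]) (auto simp: d_def)
      moreover have "p = (1, z) \<otimes>\<^bsub>Z2_Z4_power n\<^esub> (0, d)"
        using x 2 by (auto simp: p mult_Z2_Z4_power d_def fun_eq_iff mod_simps PiE_def extensional_def Pi_def)
      ultimately show ?thesis using subgroup.m_closed[OF H z] by simp
    qed
  qed
qed

lemma i_powi_mod: "\<i> powi k = \<i> powi (k mod 4)"
proof -
  have "\<i> powi k = \<i> powi (4 * (k div 4) + k mod 4)" by simp
  also have "\<dots> = (\<i> powi 4) powi (k div 4) * \<i> powi (k mod 4)"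
    by (subst power_int_add) (simp_all only: power_int_mult, simp)
  also have "\<i> powi 4 = 1" by simp
  finally show ?thesis by simp
qed

lemma i_powi_eq_iff: "\<i> powi k = \<i> powi l \<longleftrightarrow> k mod 4 = l mod 4"
proof
  assume eq: "\<i> powi k = \<i> powi l"
  have "k mod 4 \<in> {0..<4}" "l mod 4 \<in> {0..<4}" by auto
  moreover have "{0..<4} = {0, 1, 2, 3::int}" by auto
  moreover have "\<i> powi (k mod 4) = \<i> powi (l mod 4)" using eq by (simp flip: i_powi_mod)
  ultimately show "k mod 4 = l mod 4"
    by (auto simp: complex_eq_iff power2_eq_square power3_eq_cube)
qed (metis i_powi_mod)

lemma i_powi_sum: "\<i> powi (\<Sum>j\<in>A. f j) = (\<Prod>j\<in>A. \<i> powi (f j))"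
  by (induction A rule: infinite_finite_induct) (auto simp: power_int_add)

lemma ex_i_powi:
  assumes "z ^ 4 = (1 :: complex)"
  shows "\<exists>k\<in>{0..<4::int}. z = \<i> powi k"
proof -
  have "(z - 1) * (z + 1) * (z - \<i>) * (z + \<i>) = z ^ 4 - 1"
    by (simp add: algebra_simps power4_eq_xxxx)
  then have "z = 1 \<or> z = -1 \<or> z = \<i> \<or> z = -\<i>"
    using assms by (auto simp: eq_neg_iff_add_eq_0)
  then show ?thesis
  proof (elim disjE)
    show ?thesis if "z = 1" using that by (intro bexI[of _ 0]) auto
    show ?thesis if "z = -1" using that by (intro bexI[of _ 2]) auto
    show ?thesis if "z = \<i>" using that by (intro bexI[of _ 1]) auto
    show ?thesis if "z = -\<i>" using that by (intro bexI[of _ 3]) (auto simp: power3_eq_cube)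
  qed
qed

text \<open>The standard pairing, which sends \<open>(a, y)\<close> and \<open>(b, x)\<close> to \<open>(-1) ^ (a * b)\<close> times
  \<open>\<i>\<close> to the power \<open>\<Sum>j. y j * x j\<close>. The sign is written as \<open>\<i> powi (2 * a * b)\<close>, so that
  only powers of \<open>\<i>\<close> occur.\<close>
definition pairing :: "nat \<Rightarrow> int \<times> (nat \<Rightarrow> int) \<Rightarrow> int \<times> (nat \<Rightarrow> int) \<Rightarrow> complex" where
  "pairing n y x = \<i> powi (2 * fst y * fst x) * (\<Prod>j<n. \<i> powi (snd y j * snd x j))"

lemma pairing_commute: "pairing n y x = pairing n x y"
  by (simp add: pairing_def mult_ac)

lemma pairing_nonzero: "pairing n y x \<noteq> 0"
  by (simp add: pairing_def)

lemma pairing_mult_right: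
  "pairing n y (x \<otimes>\<^bsub>Z2_Z4_power n\<^esub> x') = pairing n y x * pairing n y x'"
proof -
  have "\<i> powi (2 * fst y * ((fst x + fst x') mod 2)) = \<i> powi (2 * fst y * fst x + 2 * fst y * fst x')"
  proof -
    have "2 * fst y * ((fst x + fst x') mod 2) mod 4 = fst y * (2 * (fst x + fst x') mod (2 * 2)) mod 4"
      by (simp only: mult_mod_right) (simp add: mult_ac)
    also have "\<dots> = (2 * fst y * fst x + 2 * fst y * fst x') mod 4"
      by (simp add: mod_simps algebra_simps)
    finally show ?thesis by (simp only: i_powi_eq_iff)
  qed
  moreover have "\<i> powi (snd y j * ((snd x j + snd x' j) mod 4))
      = \<i> powi (snd y j * snd x j + snd y j * snd x' j)" for j
    by (simp only: i_powi_eq_iff) (simp add: mod_simps algebra_simps)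
  ultimately show ?thesis
    by (simp add: pairing_def mult_Z2_Z4_power power_int_add prod.distrib)
qed

lemma pairing_single: 
  assumes "j < n" shows "pairing n y (0, single n j 1) = \<i> powi (snd y j)"
proof -
  have "(\<Prod>k<n. \<i> powi (snd y k * single n j 1 k)) = (\<Prod>k<n. if k = j then \<i> powi (snd y j) else 1)"
    by (intro prod.cong) (auto simp: single_def)
  with assms show ?thesis by (simp add: pairing_def)
qed

lemma pairing_one_zero: "pairing n y (1, \<lambda>i\<in>{..<n}. 0) = \<i> powi (2 * fst y)"
  by (simp add: pairing_def)

text \<open>The character given by pairing with \<open>y\<close>, undefined off the carrier as the dual group
  requires.\<close>
definition pairing_char :: "nat \<Rightarrow> int \<times> (nat \<Rightarrow> int) \<Rightarrow> int \<times> (nat \<Rightarrow> int) \<Rightarrow> complex" where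
  "pairing_char n y = restrict (pairing n y) (carrier (Z2_Z4_power n))"

lemma single_in_carrier: "(0, single n j 1) \<in> carrier (Z2_Z4_power n)"
  "(1, \<lambda>i\<in>{..<n}. 0) \<in> carrier (Z2_Z4_power n)"
  using single_in_PiE[of 1 n j] by (auto simp: carrier_Z2_Z4_power)

text \<open>A character is determined by its values on generators: the set on which it agrees with
  a given pairing is a subgroup.\<close>
lemma pairing_char_eqI:
  assumes \<chi>: "\<chi> \<in> characters (Z2_Z4_power n)"
    and e: "\<And>j. j < n \<Longrightarrow> \<chi> (0, single n j 1) = \<i> powi (snd y j)"
    and a: "\<chi> (1, \<lambda>i\<in>{..<n}. 0) = \<i> powi (2 * fst y)"
  shows "\<chi> = pairing_char n y"
proof -
  interpret group "Z2_Z4_power n" by (rule group_Z2_Z4_power)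
  let ?G = "Z2_Z4_power n"
  have mult: "\<chi> (x \<otimes>\<^bsub>?G\<^esub> x') = \<chi> x * \<chi> x'" if "x \<in> carrier ?G" "x' \<in> carrier ?G" for x x'
    using \<chi> that by (auto simp: characters_def hom_def complex_mult_group_def)
  have nz: "\<chi> x \<noteq> 0" if "x \<in> carrier ?G" for x
    using \<chi> that by (auto simp: characters_def hom_def complex_mult_group_def)
  have one: "\<chi> \<one>\<^bsub>?G\<^esub> = 1" using mult[of "\<one>\<^bsub>?G\<^esub>" "\<one>\<^bsub>?G\<^esub>"] nz[of "\<one>\<^bsub>?G\<^esub>"] by simp
  have pone: "pairing n y \<one>\<^bsub>?G\<^esub> = 1" by (simp add: one_Z2_Z4_power pairing_def)
  define H where "H = {x \<in> carrier ?G. \<chi> x = pairing n y x}"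
  have "subgroup H ?G"
  proof (rule subgroupI)
    show "H \<subseteq> carrier ?G" by (auto simp: H_def)
    have "\<one>\<^bsub>?G\<^esub> \<in> H" using one pone by (simp add: H_def)
    then show "H \<noteq> {}" by blast
    show "inv\<^bsub>?G\<^esub> x \<in> H" if "x \<in> H" for x
    proof -
      have x: "x \<in> carrier ?G" "\<chi> x = pairing n y x" using that by (auto simp: H_def)
      have "\<chi> (inv\<^bsub>?G\<^esub> x) * \<chi> x = 1" using mult[of "inv\<^bsub>?G\<^esub> x" x] x one by simp
      moreover have "pairing n y (inv\<^bsub>?G\<^esub> x) * pairing n y x = 1"
        using pairing_mult_right[of n y "inv\<^bsub>?G\<^esub> x" x] x pone by simp
      ultimately have "\<chi> (inv\<^bsub>?G\<^esub> x) = pairing n y (inv\<^bsub>?G\<^esub> x)"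
        using x pairing_nonzero by (metis mult_cancel_right)
      then show ?thesis using x by (simp add: H_def)
    qed
    show "x \<otimes>\<^bsub>?G\<^esub> x' \<in> H" if "x \<in> H" "x' \<in> H" for x x'
      using that by (auto simp: H_def mult pairing_mult_right)
  qed
  then have "H = carrier ?G"
    by (rule subgroup_Z2_Z4_power_eq_carrier[where z = "\<lambda>i\<in>{..<n}. 0"])
      (use e a single_in_carrier in \<open>auto simp: H_def pairing_single pairing_one_zero simp del: restrict_apply\<close>)
  then have "\<chi> x = pairing n y x" if "x \<in> carrier ?G" for x
    using that by (auto simp: H_def)
  moreover have "\<chi> \<in> extensional (carrier ?G)" using \<chi> by (simp add: characters_def)
  ultimately show ?thesis by (auto simp: pairing_char_def fun_eq_iff extensional_def)
qed

text \<open>Surjectivity holds because a character takes a fourth root of unity on each unit vector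
  and a sign on the element of order two in the first factor, and these values prescribe \<open>y\<close>.\<close>
lemma pairing_char_iso: "pairing_char n \<in> iso (Z2_Z4_power n) (dual_group (Z2_Z4_power n))"
proof -
  let ?G = "Z2_Z4_power n"
  interpret group ?G by (rule group_Z2_Z4_power)
  have char: "pairing_char n y \<in> characters ?G" for y
    by (auto simp: characters_def hom_def complex_mult_group_def pairing_char_def pairing_mult_right pairing_nonzero)
  have hom: "pairing_char n \<in> hom ?G (dual_group ?G)"
  proof (rule homI)
    fix y y' assume "y \<in> carrier ?G" "y' \<in> carrier ?G"
    have "pairing n (y \<otimes>\<^bsub>?G\<^esub> y') x = pairing n y x * pairing n y' x" for x
      using pairing_mult_right[of n x y y'] by (simp add: pairing_commute)
    then show "pairing_char n (y \<otimes>\<^bsub>?G\<^esub> y') = pairing_char n y \<otimes>\<^bsub>dual_group ?G\<^esub> pairing_char n y'"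
      by (auto simp: dual_group_def pairing_char_def fun_eq_iff)
  qed (simp add: dual_group_def char)
  have inj: "inj_on (pairing_char n) (carrier ?G)"
  proof (rule inj_onI)
    fix y y' assume y: "y \<in> carrier ?G" "y' \<in> carrier ?G" and eq: "pairing_char n y = pairing_char n y'"
    have pe: "pairing n y x = pairing n y' x" if "x \<in> carrier ?G" for x
      using fun_cong[OF eq, of x] that by (simp add: pairing_char_def)
    have coord: "snd y j = snd y' j" if "j < n" for j
    proof -
      have "snd y j mod 4 = snd y' j mod 4"
        using pe[OF single_in_carrier(1)[of n j]] that by (simp add: pairing_single i_powi_eq_iff)
      moreover have "snd y j \<in> {0..<4}" "snd y' j \<in> {0..<4}"
        using y that by (auto simp: carrier_Z2_Z4_power PiE_def Pi_def)
      ultimately show ?thesis by simp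
    qed
    have "snd y \<in> PiE {..<n} (\<lambda>_. {0..<4})" "snd y' \<in> PiE {..<n} (\<lambda>_. {0..<4})"
      using y by (simp_all only: carrier_Z2_Z4_power mem_Times_iff)
    then have "snd y = snd y'" by (rule PiE_ext) (simp add: coord)
    moreover have parity: "(2 * fst y) mod 4 = (2 * fst y') mod 4"
      using pe[OF single_in_carrier(2)[of n]] by (simp only: pairing_one_zero i_powi_eq_iff)
    moreover have "fst y \<in> {0..<2}" "fst y' \<in> {0..<2}"
      using y by (simp_all only: carrier_Z2_Z4_power mem_Times_iff)
    then have "fst y = fst y'"
      using parity unfolding atLeastLessThan_iff by presburger
    ultimately show "y = y'" by (simp add: prod_eq_iff)
  qed
  have "\<chi> \<in> pairing_char n ` carrier ?G" if \<chi>: "\<chi> \<in> characters ?G" for \<chi>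
  proof -
    have mult: "\<chi> (x \<otimes>\<^bsub>?G\<^esub> x') = \<chi> x * \<chi> x'" if "x \<in> carrier ?G" "x' \<in> carrier ?G" for x x'
      using \<chi> that by (auto simp: characters_def hom_def complex_mult_group_def)
    have one: "\<chi> \<one>\<^bsub>?G\<^esub> = 1"
      using mult[of "\<one>\<^bsub>?G\<^esub>" "\<one>\<^bsub>?G\<^esub>"] \<chi> by (auto simp: characters_def hom_def complex_mult_group_def)
    let ?e = "\<lambda>j. (0, single n j 1)" and ?a = "(1, \<lambda>i\<in>{..<n}. 0)"
    have "\<exists>k\<in>{0..<4}. \<chi> (?e j) = \<i> powi k" if "j < n" for j
    proof (rule ex_i_powi)
      have c: "?e j \<in> carrier ?G" by (rule single_in_carrier)
      have "?e j \<otimes>\<^bsub>?G\<^esub> ?e j \<otimes>\<^bsub>?G\<^esub> ?e j \<otimes>\<^bsub>?G\<^esub> ?e j = \<one>\<^bsub>?G\<^esub>"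
        by (auto simp: mult_Z2_Z4_power one_Z2_Z4_power single_def fun_eq_iff)
      then have "\<chi> (?e j) * \<chi> (?e j) * \<chi> (?e j) * \<chi> (?e j) = 1"
        using c one by (simp flip: mult)
      then show "\<chi> (?e j) ^ 4 = 1" by (simp add: power4_eq_xxxx)
    qed
    then have "\<forall>j\<in>{..<n}. \<exists>k. k \<in> {0..<4} \<and> \<chi> (?e j) = \<i> powi k" by blast
    then obtain y where y: "\<And>j. j < n \<Longrightarrow> y j \<in> {0..<4} \<and> \<chi> (?e j) = \<i> powi (y j)"
      by (metis bchoice lessThan_iff)
    have "\<exists>k\<in>{0..<2}. \<chi> ?a = \<i> powi (2 * k)"
    proof -
      have c: "?a \<in> carrier ?G" by (rule single_in_carrier)
      have "?a \<otimes>\<^bsub>?G\<^esub> ?a = \<one>\<^bsub>?G\<^esub>"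
        by (auto simp: mult_Z2_Z4_power one_Z2_Z4_power fun_eq_iff)
      then have "\<chi> ?a ^ 2 = 1" using mult[OF c c] one by (simp add: power2_eq_square)
      then have "\<chi> ?a = 1 \<or> \<chi> ?a = -1" by (simp only: power2_eq_1_iff)
      then show ?thesis
      proof (elim disjE)
        show ?thesis if "\<chi> ?a = 1" using that by (intro bexI[of _ 0]) auto
        show ?thesis if "\<chi> ?a = -1" using that by (intro bexI[of _ 1]) auto
      qed
    qed
    then obtain a where a: "a \<in> {0..<2}" "\<chi> ?a = \<i> powi (2 * a)" by blast
    have "\<chi> = pairing_char n (a, restrict y {..<n})"
      by (rule pairing_char_eqI[OF \<chi>]) (use y a in auto)
    moreover have "(a, restrict y {..<n}) \<in> carrier ?G"
      using y a by (auto simp: carrier_Z2_Z4_power)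
    ultimately show ?thesis by blast
  qed
  then have "pairing_char n ` carrier ?G = carrier (dual_group ?G)"
    using char by (auto simp: dual_group_def)
  with hom inj show ?thesis by (simp add: iso_def bij_betw_def)
qed

section \<open>Three building blocks in dimension two\<close>

text \<open>The three kinds of building block. \<open>Grid\<close> is the square of the self-dual set \<open>{0, 1}\<close> in
  \<open>\<int>\<^sub>4\<close>. \<open>Galois\<close> is the Teichmueller set of the Galois ring with 16 elements, a difference
  set of \<open>\<int>\<^sub>4\<^sup>2\<close> relative to \<open>2\<int>\<^sub>4\<^sup>2\<close>. Both ignore the factor \<open>\<int>\<^sub>2\<close>. \<open>Bent\<close> combines the
  Teichmueller set with the bent function \<open>uv\<close> of the residues modulo 2, and is the kind that
  involves \<open>\<int>\<^sub>2\<close>.\<close>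
datatype block = Grid | Galois | Bent

text \<open>A transversal of \<open>2\<int>\<^sub>4\<^sup>2\<close> in \<open>\<int>\<^sub>4\<^sup>2\<close>; residues modulo 4 are represented by \<open>0, ..., 3\<close>.\<close>
definition base :: "block \<Rightarrow> (int \<times> int) set" where
  "base t = (if t = Grid then {(0, 0), (1, 0), (0, 1), (1, 1)} else {(0, 0), (1, 0), (0, 1), (3, 3)})"

text \<open>The part of the block of \<open>T\<close> that lies over \<open>c\<close> in \<open>\<int>\<^sub>2\<close>. It depends on \<open>c\<close> only for
  \<open>Bent\<close>, where the sheet over 1 is the negative of the base.\<close>
definition sheet :: "block \<Rightarrow> int \<Rightarrow> (int \<times> int) set" where
  "sheet t c = (if t = Bent \<and> c = 1 then {(0, 0), (3, 0), (0, 3), (1, 1)} else base t)"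

text \<open>The first coordinate attached to a base element in the block of \<open>S\<close>. For \<open>Bent\<close> it is the
  product of the two residues modulo 2, which on the base is 1 only at \<open>(3, 3)\<close>.\<close>
definition weight :: "block \<Rightarrow> int \<times> int \<Rightarrow> int" where
  "weight t d = (if t = Bent \<and> d = (3, 3) then 1 else 0)"

text \<open>Addition in \<open>\<int>\<^sub>4\<^sup>2\<close>.\<close>
definition add4 :: "int \<times> int \<Rightarrow> int \<times> int \<Rightarrow> int \<times> int" where
  "add4 d e = ((fst d + fst e) mod 4, (snd d + snd e) mod 4)"

text \<open>How often \<open>d\<close> is a difference of an element of the sheet over \<open>a\<close> and one of the sheet
  over 0.\<close>
definition overlap :: "block \<Rightarrow> int \<Rightarrow> int \<times> int \<Rightarrow> nat" where
  "overlap t a d = card {e \<in> sheet t 0. add4 d e \<in> sheet t a}"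

text \<open>The group \<open>\<int>\<^sub>4\<^sup>2\<close> as an explicit set of representatives.\<close>
definition square4 :: "(int \<times> int) set" where
  "square4 = {0, 1, 2, 3} \<times> {0, 1, 2, 3}"

text \<open>Real and imaginary part of \<open>\<i> powi k\<close> as integers, which turn the block identity below
  into a computation with integers.\<close>
definition i_re :: "int \<Rightarrow> int" where
  "i_re k = (if k mod 4 = 0 then 1 else if k mod 4 = 2 then -1 else 0)"

definition i_im :: "int \<Rightarrow> int" where
  "i_im k = (if k mod 4 = 1 then 1 else if k mod 4 = 3 then -1 else 0)"

lemma Re_Im_i_powi: "Re (\<i> powi k) = of_int (i_re k)" "Im (\<i> powi k) = of_int (i_im k)"
proof -
  have "k mod 4 \<in> {0, 1, 2, 3}" by (simp; presburger)
  then have "Re (\<i> powi (k mod 4)) = of_int (i_re k) \<and> Im (\<i> powi (k mod 4)) = of_int (i_im k)"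
    by (auto simp: i_re_def i_im_def power3_eq_cube)
  then show "Re (\<i> powi k) = of_int (i_re k)" "Im (\<i> powi k) = of_int (i_im k)"
    by (simp_all flip: i_powi_mod)
qed

text \<open>Formal duality of a single block: for each of the 32 characters of \<open>\<int>\<^sub>2 \<times> \<int>\<^sub>4\<^sup>2\<close> the
  squared modulus of the sum over the block of \<open>S\<close> is 4 times the overlap.\<close>
lemma block_identity_table: 
  "\<forall>t\<in>{Grid, Galois, Bent}. \<forall>a\<in>{0, 1}. \<forall>d\<in>square4.
    (\<Sum>e\<in>base t. i_re (2 * a * weight t e + fst d * fst e + snd d * snd e))\<^sup>2
    + (\<Sum>e\<in>base t. i_im (2 * a * weight t e + fst d * fst e + snd d * snd e))\<^sup>2
    = 4 * int (overlap t a d)"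
  by code_simp

text \<open>The number of times \<open>d\<close> is a difference of elements of two sheets depends only on the
  difference \<open>a\<close> of their indices. For this reason the blocks of \<open>T\<close> may be glued along their common first coordinate.\<close>
lemma overlap_shift_table: 
  "\<forall>t\<in>{Grid, Galois, Bent}. \<forall>a\<in>{0, 1}. \<forall>d\<in>square4. \<forall>c\<in>{0, 1}.
     card {e \<in> sheet t c. add4 d e \<in> sheet t ((a + c) mod 2)} = overlap t a d"
  by code_simp

text \<open>The sizes of the supports of the overlaps, from which the invariant that separates the
  pairs is computed.\<close>
lemma card_overlap_support:
  "(\<forall>a\<in>{0,1}. card {d\<in>square4. overlap Grid a d \<noteq> 0} = 9 \<and> 
     card {d\<in>square4. overlap Galois a d \<noteq> 0} = 13) \<and>
   card {d\<in>square4. overlap Bent 0 d \<noteq> 0} = 13 \<and> 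
   card {d\<in>square4. overlap Bent 1 d \<noteq> 0} = 10"
  by code_simp

lemma sheet_subset: "sheet t c \<subseteq> square4" and base_subset: "base t \<subseteq> square4"
  by (auto simp: sheet_def base_def square4_def)

lemma finite_square4: "finite square4"
  by (simp add: square4_def)

lemma square4_eq: "square4 = {0..<4} \<times> {0..<4}"
proof -
  have "{0, 1, 2, 3} = {0..<4 :: int}" by auto
  then show ?thesis by (simp only: square4_def)
qed

lemma overlap_shift:
  assumes "a \<in> {0, 1}" "c \<in> {0, 1}" "d \<in> square4"
  shows "card {e \<in> sheet t c. add4 d e \<in> sheet t ((a + c) mod 2)} = overlap t a d"
  using overlap_shift_table assms by (cases t) blast+

lemma norm_block_sum:
  assumes "a \<in> {0, 1}" "d \<in> square4"
  shows "(cmod (\<Sum>e\<in>base t. \<i> powi (2 * a * weight t e + (fst d * fst e + snd d * snd e))))\<^sup>2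
    = 4 * real (overlap t a d)"
proof -
  have "(\<Sum>e\<in>base t. i_re (2 * a * weight t e + fst d * fst e + snd d * snd e))\<^sup>2
    + (\<Sum>e\<in>base t. i_im (2 * a * weight t e + fst d * fst e + snd d * snd e))\<^sup>2
    = 4 * int (overlap t a d)"
    using block_identity_table assms by (cases t) blast+
  from arg_cong[OF this, of real_of_int] show ?thesis
    by (simp add: cmod_power2 Re_Im_i_powi add.assoc)
qed

section \<open>Gluing blocks\<close>

text \<open>The \<open>i\<close>-th block of coordinates of a vector of length \<open>2 * m\<close>.\<close>
definition blk :: "(nat \<Rightarrow> int) \<Rightarrow> nat \<Rightarrow> int \<times> int" where
  "blk x i = (x (2 * i), x (2 * i + 1))"

text \<open>The product of subsets \<open>A i\<close> of \<open>\<int>\<^sub>4\<^sup>2\<close>, one for each \<open>i < m\<close>, inside \<open>\<int>\<^sub>4\<^sup>2\<^sup>m\<close>.\<close>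
definition block_product :: "nat \<Rightarrow> (nat \<Rightarrow> (int \<times> int) set) \<Rightarrow> (nat \<Rightarrow> int) set" where
  "block_product m A = {x \<in> PiE {..<2 * m} (\<lambda>_. {0..<4}). \<forall>i<m. blk x i \<in> A i}"

lemma finite_block_product: "finite (block_product m A)"
  by (rule finite_subset[of _ "PiE {..<2 * m} (\<lambda>_. {0..<4})"]) (auto simp: block_product_def finite_PiE)

lemma blk_in_square4: "x \<in> PiE {..<2 * m} (\<lambda>_. {0..<4}) \<Longrightarrow> i < m \<Longrightarrow> blk x i \<in> square4"
  by (auto simp: square4_eq blk_def PiE_def Pi_def)

lemma blk_eqI:
  assumes "x \<in> PiE {..<2 * m} A" "y \<in> PiE {..<2 * m} B" "\<And>i. i < m \<Longrightarrow> blk x i = blk y i"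
  shows "x = y"
proof (rule PiE_ext)
  show "x \<in> PiE {..<2 * m} (\<lambda>_. UNIV)" "y \<in> PiE {..<2 * m} (\<lambda>_. UNIV)" using assms by auto
  fix j assume j: "j \<in> {..<2 * m}"
  then have "blk x (j div 2) = blk y (j div 2)" by (intro assms(3)) auto
  then show "x j = y j" by (cases "even j") (auto simp: blk_def elim!: evenE oddE)
qed

lemma sum_prod_block_product:
  fixes f :: "nat \<Rightarrow> int \<times> int \<Rightarrow> 'c :: comm_semiring_1"
  assumes A: "\<And>i. i < m \<Longrightarrow> A i \<subseteq> square4"
  shows "(\<Sum>x\<in>block_product m A. \<Prod>i<m. f i (blk x i)) = (\<Prod>i<m. \<Sum>d\<in>A i. f i d)"
proof -
  define join where "join w = (\<lambda>j\<in>{..<2 * m}. if even j then fst (w (j div 2)) else snd (w (j div 2)))"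
    for w :: "nat \<Rightarrow> int \<times> int"
  have blk_join: "blk (join w) i = w i" if "i < m" for w i
    using that by (auto simp: blk_def join_def)
  have "(\<Prod>i<m. \<Sum>d\<in>A i. f i d) = (\<Sum>w\<in>PiE {..<m} A. \<Prod>i<m. f i (w i))"
    by (rule prod_sum_PiE) (auto intro: finite_subset[OF A finite_square4])
  also have "\<dots> = (\<Sum>x\<in>block_product m A. \<Prod>i<m. f i (blk x i))"
  proof (rule sum.reindex_bij_witness[where j = join and i = "\<lambda>x. \<lambda>i\<in>{..<m}. blk x i"])
    fix w assume w: "w \<in> PiE {..<m} A"
    then show "(\<lambda>i\<in>{..<m}. blk (join w) i) = w"
      by (auto simp: fun_eq_iff blk_join PiE_def extensional_def)
    have "w (j div 2) \<in> {0..<4} \<times> {0..<4}" if "j < 2 * m" for j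
    proof -
      have j: "j div 2 < m" using that by auto
      then have "w (j div 2) \<in> A (j div 2)" by (rule PiE_mem[OF w, OF lessThan_iff[THEN iffD2]])
      then show ?thesis using A[OF j] unfolding square4_eq by blast
    qed
    then have "join w \<in> PiE {..<2 * m} (\<lambda>_. {0..<4})"
      by (auto simp: join_def mem_Times_iff)
    then show "join w \<in> block_product m A"
      using w by (auto simp: block_product_def blk_join PiE_def Pi_def)
    show "(\<Prod>i<m. f i (blk (join w) i)) = (\<Prod>i<m. f i (w i))"
      by (simp add: blk_join)
  next
    fix x assume x: "x \<in> block_product m A"
    then show "(\<lambda>i\<in>{..<m}. blk x i) \<in> PiE {..<m} A"
      by (auto simp: block_product_def)
    show "join (\<lambda>i\<in>{..<m}. blk x i) = x"
    proof (rule blk_eqI)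
      show "join (\<lambda>i\<in>{..<m}. blk x i) \<in> PiE {..<2 * m} (\<lambda>_. UNIV)" by (auto simp: join_def)
      show "x \<in> PiE {..<2 * m} (\<lambda>_. {0..<4})" using x by (simp add: block_product_def)
    qed (simp add: blk_join)
  qed
  finally show ?thesis by simp
qed

lemma card_block_product:
  assumes "\<And>i. i < m \<Longrightarrow> A i \<subseteq> square4"
  shows "card (block_product m A) = (\<Prod>i<m. card (A i))"
  using sum_prod_block_product[OF assms, where f = "\<lambda>_ _. 1 :: nat"] by simp

lemma prod_pairs: "(\<Prod>j<2 * m. h j) = (\<Prod>i<m. h (2 * i) * h (2 * i + 1 :: nat))"
  by (induction m) (simp_all add: mult_ac)

lemma fst_carrier: "y \<in> carrier (Z2_Z4_power n) \<Longrightarrow> fst y \<in> {0, 1}"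
proof -
  assume "y \<in> carrier (Z2_Z4_power n)"
  then have "fst y \<in> {0..<2}" by (simp only: carrier_Z2_Z4_power mem_Times_iff)
  then show ?thesis by auto
qed

lemma snd_carrier: "y \<in> carrier (Z2_Z4_power n) \<Longrightarrow> snd y \<in> PiE {..<n} (\<lambda>_. {0..<4})"
  by (simp only: carrier_Z2_Z4_power mem_Times_iff)

text \<open>The first member of the pair: the first coordinates of the blocks are added up.\<close>
definition dual_S :: "nat \<Rightarrow> (nat \<Rightarrow> block) \<Rightarrow> (int \<times> (nat \<Rightarrow> int)) set" where
  "dual_S m t = (\<lambda>x. ((\<Sum>i<m. weight (t i) (blk x i)) mod 2, x)) ` block_product m (\<lambda>i. base (t i))"

text \<open>The second member: the blocks share their first coordinate \<open>c\<close>, which is the Fourier dual of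
  adding the first coordinates up.\<close>
definition dual_T :: "nat \<Rightarrow> (nat \<Rightarrow> block) \<Rightarrow> (int \<times> (nat \<Rightarrow> int)) set" where
  "dual_T m t = (SIGMA c:{0, 1}. block_product m (\<lambda>i. sheet (t i) c))"

lemma dual_S_subset: "dual_S m t \<subseteq> carrier (Z2_Z4_power (2 * m))"
  and dual_T_subset: "dual_T m t \<subseteq> carrier (Z2_Z4_power (2 * m))"
  by (auto simp: dual_S_def dual_T_def block_product_def carrier_Z2_Z4_power)

lemma card_base: "card (base t) = 4" and card_sheet: "card (sheet t c) = 4"
  by (simp_all add: base_def sheet_def)

lemma card_dual_S: "card (dual_S m t) = 4 ^ m"
proof -
  have "card (dual_S m t) = card (block_product m (\<lambda>i. base (t i)))"
    unfolding dual_S_def by (rule card_image) (auto simp: inj_on_def)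
  then show ?thesis by (simp add: card_block_product base_subset card_base)
qed

lemma card_dual_T: "card (dual_T m t) = 2 * 4 ^ m"
proof -
  have "card (dual_T m t) = (\<Sum>c\<in>{0, 1}. card (block_product m (\<lambda>i. sheet (t i) c)))"
    unfolding dual_T_def by (rule card_SigmaI) (auto simp: finite_block_product)
  then show ?thesis by (simp add: card_block_product sheet_subset card_sheet)
qed

text \<open>A character of the product turns the sum of the first coordinates into a product, so the
  character sum factors over the blocks.\<close>
lemma norm_char_sum_dual_S:
  assumes y: "y \<in> carrier (Z2_Z4_power (2 * m))"
  shows "(cmod (char_sum (pairing_char (2 * m) y) (dual_S m t)))\<^sup>2
     = 4 ^ m * (\<Prod>i<m. real (overlap (t i) (fst y) (blk (snd y) i)))"
proof -
  define U where "U = block_product m (\<lambda>i. base (t i))"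
  define F where "F i e = \<i> powi (2 * fst y * weight (t i) e
      + (fst (blk (snd y) i) * fst e + snd (blk (snd y) i) * snd e))" for i e
  note a = fst_carrier[OF y]
  have d: "blk (snd y) i \<in> square4" if "i < m" for i
    by (rule blk_in_square4[OF snd_carrier[OF y] that])
  have pairing: "pairing (2 * m) y ((\<Sum>i<m. weight (t i) (blk x i)) mod 2, x) = (\<Prod>i<m. F i (blk x i))" for x
  proof -
    have "2 * fst y * (k mod 2) mod 4 = 2 * fst y * k mod 4" for k
    proof -
      have "2 * fst y * (k mod 2) mod 4 = fst y * (2 * k mod (2 * 2)) mod 4"
        by (simp only: mult_mod_right) (simp add: mult_ac)
      then show ?thesis by (simp add: mod_simps mult_ac)
    qed
    then have "\<i> powi (2 * fst y * ((\<Sum>i<m. weight (t i) (blk x i)) mod 2))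
        = \<i> powi (2 * fst y * (\<Sum>i<m. weight (t i) (blk x i)))"
      by (simp only: i_powi_eq_iff)
    also have "\<dots> = (\<Prod>i<m. \<i> powi (2 * fst y * weight (t i) (blk x i)))"
      by (simp only: sum_distrib_left i_powi_sum)
    finally show ?thesis
      by (simp add: pairing_def prod_pairs F_def blk_def power_int_add prod.distrib)
  qed
  have "char_sum (pairing_char (2 * m) y) (dual_S m t)
      = (\<Sum>p\<in>dual_S m t. pairing (2 * m) y p)"
    unfolding char_sum_def pairing_char_def
    using dual_S_subset by (intro sum.cong) auto
  also have "\<dots> = (\<Sum>x\<in>U. \<Prod>i<m. F i (blk x i))"
    unfolding dual_S_def U_def by (subst sum.reindex) (auto simp: inj_on_def pairing)
  also have "\<dots> = (\<Prod>i<m. \<Sum>e\<in>base (t i). F i e)"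
    unfolding U_def by (rule sum_prod_block_product) (rule base_subset)
  finally have "(cmod (char_sum (pairing_char (2 * m) y) (dual_S m t)))\<^sup>2
      = (\<Prod>i<m. (cmod (\<Sum>e\<in>base (t i). F i e))\<^sup>2)"
    by (simp add: prod_norm[symmetric] prod_power_distrib)
  also have "\<dots> = (\<Prod>i<m. 4 * real (overlap (t i) (fst y) (blk (snd y) i)))"
    unfolding F_def using a d by (intro prod.cong refl norm_block_sum) auto
  finally show ?thesis by (simp add: prod.distrib)
qed

text \<open>The two sheets, \<open>c = 0\<close> and \<open>c = 1\<close>, contribute equally; each contribution is a product over
  the blocks.\<close>
lemma nu_dual_T:
  assumes y: "y \<in> carrier (Z2_Z4_power (2 * m))"
  shows "nu (Z2_Z4_power (2 * m)) (dual_T m t) y = 2 * (\<Prod>i<m. overlap (t i) (fst y) (blk (snd y) i))"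
proof -
  let ?G = "Z2_Z4_power (2 * m)"
  note a = fst_carrier[OF y]
  have d: "blk (snd y) i \<in> square4" if "i < m" for i
    by (rule blk_in_square4[OF snd_carrier[OF y] that])
  \<comment> \<open>The elements of a block over \<open>c\<close> that stay in the block after translation by \<open>y\<close>.\<close>
  define E where "E c i = {e \<in> sheet (t i) c. add4 (blk (snd y) i) e \<in> sheet (t i) ((fst y + c) mod 2)}"
    for c i
  have add: "blk (snd (y \<otimes>\<^bsub>?G\<^esub> (c, x))) i = add4 (blk (snd y) i) (blk x i)" if "i < m" for c x i
    using that by (simp add: mult_Z2_Z4_power blk_def add4_def)
  have sum_in: "snd (y \<otimes>\<^bsub>?G\<^esub> (c, x)) \<in> PiE {..<2 * m} (\<lambda>_. {0..<4})" for c x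
    by (auto simp: mult_Z2_Z4_power)
  have mem: "y \<otimes>\<^bsub>?G\<^esub> (c, x) \<in> dual_T m t \<longleftrightarrow>
      (\<forall>i<m. add4 (blk (snd y) i) (blk x i) \<in> sheet (t i) ((fst y + c) mod 2))" for c x
  proof -
    have f: "fst (y \<otimes>\<^bsub>?G\<^esub> (c, x)) = (fst y + c) mod 2" by (simp add: mult_Z2_Z4_power)
    have "(fst y + c) mod 2 \<in> {0, 1}" by auto
    then show ?thesis
      using sum_in[of c x] f add[of _ c x]
      by (cases "y \<otimes>\<^bsub>?G\<^esub> (c, x)") (simp add: dual_T_def block_product_def)
  qed
  have "nu ?G (dual_T m t) y = card {p \<in> dual_T m t. y \<otimes>\<^bsub>?G\<^esub> p \<in> dual_T m t}"
    by (rule nu_eq_card_translate[OF group_Z2_Z4_power dual_T_subset y])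
  also have "{p \<in> dual_T m t. y \<otimes>\<^bsub>?G\<^esub> p \<in> dual_T m t} = (SIGMA c:{0, 1}. block_product m (E c))"
    by (auto simp: mem) (auto simp: dual_T_def block_product_def E_def)
  also have "card \<dots> = (\<Sum>c\<in>{0, 1}. card (block_product m (E c)))"
    by (rule card_SigmaI) (auto simp: finite_block_product)
  also have "\<dots> = (\<Sum>c\<in>{0, 1::int}. \<Prod>i<m. overlap (t i) (fst y) (blk (snd y) i))"
  proof (rule sum.cong[OF refl])
    fix c :: int assume c: "c \<in> {0, 1}"
    have "E c i \<subseteq> square4" for i using sheet_subset unfolding E_def by blast
    then have "card (block_product m (E c)) = (\<Prod>i<m. card (E c i))"
      by (simp add: card_block_product)
    also have "\<dots> = (\<Prod>i<m. overlap (t i) (fst y) (blk (snd y) i))"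
      unfolding E_def using a c d by (intro prod.cong refl overlap_shift) auto
    finally show "card (block_product m (E c)) = (\<Prod>i<m. overlap (t i) (fst y) (blk (snd y) i))" .
  qed
  finally show ?thesis by simp
qed

lemma formally_dual_pair_dual: "formally_dual_pair (Z2_Z4_power (2 * m)) (dual_S m t) (dual_T m t)"
proof -
  have "dual_S m t \<noteq> {}" "dual_T m t \<noteq> {}"
    using card_dual_S[of m t] card_dual_T[of m t] by fastforce+
  moreover have "(cmod (char_sum (pairing_char (2 * m) y) (dual_S m t)))\<^sup>2
    = (real (card (dual_S m t)))\<^sup>2 / real (card (dual_T m t)) * real (nu (Z2_Z4_power (2 * m)) (dual_T m t) y)"
    if "y \<in> carrier (Z2_Z4_power (2 * m))" for y
    unfolding norm_char_sum_dual_S[OF that] nu_dual_T[OF that] card_dual_S card_dual_T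
    by (simp add: power2_eq_square)
  ultimately show ?thesis
    unfolding formally_dual_pair_def using dual_S_subset dual_T_subset pairing_char_iso by blast
qed

lemma diff_count_dual_T:
  "diff_count (Z2_Z4_power (2 * m)) (dual_T m t)
    = (\<Prod>i<m. card {d \<in> square4. overlap (t i) 0 d \<noteq> 0}) + (\<Prod>i<m. card {d \<in> square4. overlap (t i) 1 d \<noteq> 0})"
proof -
  let ?G = "Z2_Z4_power (2 * m)" and ?A = "\<lambda>a i. {d \<in> square4. overlap (t i) a d \<noteq> 0}"
  have "{y \<in> carrier ?G. nu ?G (dual_T m t) y \<noteq> 0} = (SIGMA a:{0, 1}. block_product m (?A a))"
  proof (rule Set.set_eqI)
    fix y :: "int \<times> (nat \<Rightarrow> int)"
    obtain a x where y: "y = (a, x)" by (cases y)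
    have "y \<in> {y \<in> carrier ?G. nu ?G (dual_T m t) y \<noteq> 0} \<longleftrightarrow>
        y \<in> carrier ?G \<and> (\<forall>i<m. overlap (t i) (fst y) (blk (snd y) i) \<noteq> 0)"
      by (auto simp: nu_dual_T)
    also have "\<dots> \<longleftrightarrow> a \<in> {0, 1} \<and> x \<in> PiE {..<2 * m} (\<lambda>_. {0..<4}) \<and> (\<forall>i<m. overlap (t i) a (blk x i) \<noteq> 0)"
      by (auto simp: y carrier_Z2_Z4_power)
    also have "\<dots> \<longleftrightarrow> y \<in> (SIGMA a:{0, 1}. block_product m (?A a))"
      using blk_in_square4[of x m] by (auto simp: y block_product_def)
    finally show "y \<in> {y \<in> carrier ?G. nu ?G (dual_T m t) y \<noteq> 0} \<longleftrightarrow> y \<in> (SIGMA a:{0, 1}. block_product m (?A a))" .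
  qed
  then have "diff_count ?G (dual_T m t) = (\<Sum>a\<in>{0, 1}. card (block_product m (?A a)))"
    unfolding diff_count_def by (simp only:) (rule card_SigmaI, auto simp: finite_block_product)
  then show ?thesis by (simp add: card_block_product)
qed

section \<open>Primitivity\<close>

text \<open>The base is a transversal modulo 2 that contains 0, so it contains no other even element,
  and the even elements of a sheet are also only 0.\<close>
lemma zero_if_double_in_base: 
  "\<lbrakk>d \<in> sheet t c; add4 d d \<in> base t\<rbrakk> \<Longrightarrow> d = (0, 0)"
  by (auto simp: sheet_def base_def add4_def split: if_splits)

lemma zero_in: "(0, 0) \<in> base t" "(0, 0) \<in> sheet t c"
  by (auto simp: sheet_def base_def)

lemma unit_in: "(1, 0) \<in> base t" "(0, 1) \<in> base t"
  by (auto simp: base_def)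

lemma sheet_0: "sheet t 0 = base t"
  by (simp add: sheet_def)

lemma blk_zero: "i < m \<Longrightarrow> blk (\<lambda>j\<in>{..<2 * m}. 0) i = (0, 0)"
  by (simp add: blk_def)

lemma eq_zero_if_blk_zero:
  assumes "x \<in> PiE {..<2 * m} (\<lambda>_. {0..<4})" "\<And>i. i < m \<Longrightarrow> blk x i = (0, 0)"
  shows "x = (\<lambda>j\<in>{..<2 * m}. 0)"
  by (rule blk_eqI[OF assms(1), of _ "\<lambda>_. UNIV"]) (auto simp: assms(2) blk_zero)

lemma blk_single: "i < m \<Longrightarrow> blk (single (2 * m) j 1) i = (if j = 2 * i then (1, 0) else if j = 2 * i + 1 then (0, 1) else (0, 0))"
  by (auto simp: blk_def single_def)

lemma blk_single_in_base: "i < m \<Longrightarrow> blk (single (2 * m) j 1) i \<in> base t"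
  by (simp add: blk_single zero_in unit_in)

lemma weight_zero: "weight t (0, 0) = 0"
  by (simp add: weight_def)

lemma weight_blk_single: "i < m \<Longrightarrow> weight t (blk (single (2 * m) j 1) i) = 0"
  by (simp add: blk_single weight_def)

lemma dual_S_iff:
  "(b, x) \<in> dual_S m t \<longleftrightarrow> x \<in> block_product m (\<lambda>i. base (t i)) \<and> b = (\<Sum>i<m. weight (t i) (blk x i)) mod 2"
  by (auto simp: dual_S_def)

lemma dual_T_iff:
  "(c, x) \<in> dual_T m t \<longleftrightarrow> c \<in> {0, 1} \<and> x \<in> block_product m (\<lambda>i. sheet (t i) c)"
  by (auto simp: dual_T_def)

lemma single_in_block_product: "single (2 * m) j 1 \<in> block_product m (\<lambda>i. base (t i))"
  by (simp add: block_product_def single_in_PiE blk_single_in_base)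

lemma zero_in_block_product:
  assumes "\<And>i. i < m \<Longrightarrow> (0, 0) \<in> A i"
  shows "(\<lambda>j\<in>{..<2 * m}. 0) \<in> block_product m A"
  using assms by (auto simp: block_product_def blk_zero)

lemma blk_mult: "i < m \<Longrightarrow> blk (snd (h \<otimes>\<^bsub>Z2_Z4_power (2 * m)\<^esub> p)) i = add4 (blk (snd h) i) (blk (snd p) i)"
  by (simp add: mult_Z2_Z4_power blk_def add4_def)

text \<open>If \<open>h\<close> translates the set into itself, then \<open>h\<close> and \<open>h + h\<close> lie in it because 0 does, and
  as the blocks are transversals modulo 2 this leaves only \<open>h = 0\<close>. A \<open>Bent\<close> block is needed to
  reach the factor \<open>\<int>\<^sub>2\<close>.\<close>
lemma primitive_dual_S:
  assumes m: "0 < m" and t0: "t 0 = Bent"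
  shows "primitive_subset (Z2_Z4_power (2 * m)) (dual_S m t)"
proof (rule primitive_subsetI[OF group_Z2_Z4_power dual_S_subset])
  let ?G = "Z2_Z4_power (2 * m)"
  show one: "\<one>\<^bsub>?G\<^esub> \<in> dual_S m t"
    by (simp add: one_Z2_Z4_power dual_S_iff zero_in_block_product zero_in blk_zero weight_zero)
  show "H = carrier ?G" if H: "subgroup H ?G" and sub: "dual_S m t \<subseteq> H" for H
  proof (rule subgroup_Z2_Z4_power_eq_carrier[OF H])
    fix j assume "j < 2 * m"
    have "(0, single (2 * m) j 1) \<in> dual_S m t"
      by (simp add: dual_S_iff single_in_block_product weight_blk_single)
    then show "(0, single (2 * m) j 1) \<in> H" using sub by blast
  next
    \<comment> \<open>The vector \<open>(3, 3)\<close> in block 0, the base element of \<open>Bent\<close> that has weight 1.\<close>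
    define z where "z = (\<lambda>j\<in>{..<2 * m}. if j < 2 then 3 else 0 :: int)"
    have blk_z: "blk z i = (if i = 0 then (3, 3) else (0, 0))" if "i < m" for i
      using that by (auto simp: z_def blk_def)
    have "(\<Sum>i<m. weight (t i) (blk z i)) = (\<Sum>i<m. if i = 0 then 1 else 0)"
      by (intro sum.cong) (auto simp: blk_z t0 weight_def)
    also have "\<dots> = 1" using m by simp
    finally have "(1, z) \<in> dual_S m t"
      by (auto simp: dual_S_iff block_product_def blk_z t0 zero_in) (auto simp: z_def base_def t0)
    then show "(1, z) \<in> H" using sub by blast
  qed
  fix h assume h: "h \<in> carrier ?G" and per: "\<And>p. p \<in> dual_S m t \<Longrightarrow> h \<otimes>\<^bsub>?G\<^esub> p \<in> dual_S m t"
  interpret group ?G by (rule group_Z2_Z4_power)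
  obtain b x where hb: "h = (b, x)" by (cases h)
  have hS: "h \<in> dual_S m t" using per[OF one] h by simp
  obtain c z where hh: "h \<otimes>\<^bsub>?G\<^esub> h = (c, z)" by (cases "h \<otimes>\<^bsub>?G\<^esub> h")
  have "blk x i = (0, 0)" if "i < m" for i
  proof (rule zero_if_double_in_base[of _ "t i" 0])
    show "blk x i \<in> sheet (t i) 0"
      using hS that by (simp add: hb dual_S_iff block_product_def sheet_0)
    show "add4 (blk x i) (blk x i) \<in> base (t i)"
    proof -
      have "blk z i \<in> base (t i)"
        using per[OF hS] that by (simp add: hh dual_S_iff block_product_def)
      then show ?thesis using blk_mult[OF that, of h h] hh by (simp add: hb)
    qed
  qed
  then have "x = (\<lambda>j\<in>{..<2 * m}. 0)"
    using hS by (intro eq_zero_if_blk_zero) (auto simp: hb dual_S_iff block_product_def)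
  then show "h = \<one>\<^bsub>?G\<^esub>"
    using hS by (simp add: hb dual_S_iff one_Z2_Z4_power blk_zero weight_zero)
qed

text \<open>As for \<open>S\<close>, a translation \<open>h\<close> of the set into itself has zero second component. It cannot
  be \<open>(1, 0)\<close>, since the two sheets of a \<open>Bent\<close> block differ.\<close>
lemma primitive_dual_T:
  assumes m: "0 < m" and t0: "t 0 = Bent"
  shows "primitive_subset (Z2_Z4_power (2 * m)) (dual_T m t)"
proof (rule primitive_subsetI[OF group_Z2_Z4_power dual_T_subset])
  let ?G = "Z2_Z4_power (2 * m)"
  show one: "\<one>\<^bsub>?G\<^esub> \<in> dual_T m t"
    by (simp add: one_Z2_Z4_power dual_T_iff zero_in_block_product zero_in)
  have e: "(0, single (2 * m) j 1) \<in> dual_T m t" for j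
    by (simp add: dual_T_iff sheet_0 single_in_block_product)
  show "H = carrier ?G" if H: "subgroup H ?G" and sub: "dual_T m t \<subseteq> H" for H
  proof (rule subgroup_Z2_Z4_power_eq_carrier[OF H])
    show "(0, single (2 * m) j 1) \<in> H" for j using e sub by blast
    have "(1, \<lambda>j\<in>{..<2 * m}. 0) \<in> dual_T m t"
      by (simp add: dual_T_iff zero_in_block_product zero_in)
    then show "(1, \<lambda>j\<in>{..<2 * m}. 0) \<in> H" using sub by blast
  qed
  fix h assume h: "h \<in> carrier ?G" and per: "\<And>p. p \<in> dual_T m t \<Longrightarrow> h \<otimes>\<^bsub>?G\<^esub> p \<in> dual_T m t"
  interpret group ?G by (rule group_Z2_Z4_power)
  obtain c x where hb: "h = (c, x)" by (cases h)
  have hT: "h \<in> dual_T m t" using per[OF one] h by simp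
  then have c: "c \<in> {0, 1}" by (simp add: hb dual_T_iff)
  obtain z where hh: "h \<otimes>\<^bsub>?G\<^esub> h = (0, z)"
    using c by (cases "h \<otimes>\<^bsub>?G\<^esub> h") (auto simp: mult_Z2_Z4_power hb)
  have blk_0: "blk x i = (0, 0)" if "i < m" for i
  proof (rule zero_if_double_in_base)
    show "blk x i \<in> sheet (t i) c"
      using hT that by (simp add: hb dual_T_iff block_product_def)
    show "add4 (blk x i) (blk x i) \<in> base (t i)"
    proof -
      have "blk z i \<in> base (t i)"
        using per[OF hT] that by (simp add: hh dual_T_iff block_product_def sheet_0)
      then show ?thesis using blk_mult[OF that, of h h] hh by (simp add: hb)
    qed
  qed
  then have x: "x = (\<lambda>j\<in>{..<2 * m}. 0)"
    using hT by (intro eq_zero_if_blk_zero) (auto simp: hb dual_T_iff block_product_def)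
  have "c \<noteq> 1"
  proof
    assume "c = 1"
    \<comment> \<open>Translation by \<open>h\<close> moves \<open>(1, 0)\<close> in block 0 from the sheet over 0 to the sheet over 1.\<close>
    obtain w where w: "h \<otimes>\<^bsub>?G\<^esub> (0, single (2 * m) 0 1) = (1, w)"
      using \<open>c = 1\<close> by (cases "h \<otimes>\<^bsub>?G\<^esub> (0, single (2 * m) 0 1)") (auto simp: mult_Z2_Z4_power hb)
    have "blk w 0 = (1, 0)"
      using blk_mult[OF m, of h "(0, single (2 * m) 0 1)"] w hb blk_0[OF m] blk_single[OF m, of 0]
      by (simp add: add4_def)
    moreover have "blk w 0 \<in> sheet Bent 1"
      using per[OF e[of 0]] w m t0 by (auto simp: dual_T_iff block_product_def)
    ultimately show False by (simp add: sheet_def)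
  qed
  with c x show "h = \<one>\<^bsub>?G\<^esub>" by (simp add: hb one_Z2_Z4_power)
qed

section \<open>A family of inequivalent pairs\<close>

text \<open>For \<open>k > 0\<close> the first \<open>k\<close> blocks are of kind \<open>Bent\<close> and the others of kind \<open>Grid\<close>. These are
  \<open>m\<close> choices; the index \<open>0\<close> stands for one more, with one \<open>Bent\<close> block, one \<open>Galois\<close> block and
  otherwise \<open>Grid\<close>.\<close>
definition block_types :: "nat \<Rightarrow> nat \<Rightarrow> block" where
  "block_types k i = (if k = 0 then (if i = 0 then Bent else if i = 1 then Galois else Grid)
                      else (if i < k then Bent else Grid))"

lemma prod_lessThan_split:
  assumes "k \<le> m"
  shows "(\<Prod>i<m. if i < k then a else b :: nat) = a ^ k * b ^ (m - k)"
  using assms by (induction rule: dec_induct) (simp_all add: Suc_diff_le)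

lemma diff_count_family:
  assumes k: "0 < k" "k \<le> m"
  shows "diff_count (Z2_Z4_power (2 * m)) (dual_T m (block_types k)) = 9 ^ (m - k) * (13 ^ k + 10 ^ k)"
proof -
  have "(\<Prod>i<m. card {d \<in> square4. overlap (block_types k i) 0 d \<noteq> 0}) = (\<Prod>i<m. if i < k then 13 else 9)"
    "(\<Prod>i<m. card {d \<in> square4. overlap (block_types k i) 1 d \<noteq> 0}) = (\<Prod>i<m. if i < k then 10 else 9)"
    using k card_overlap_support by (auto intro!: prod.cong simp: block_types_def)
  then show ?thesis
    by (simp only: diff_count_dual_T prod_lessThan_split[OF k(2)]) (simp add: algebra_simps)
qed

lemma diff_count_family_0:
  "diff_count (Z2_Z4_power (2 * Suc (Suc r))) (dual_T (Suc (Suc r)) (block_types 0)) = 299 * 9 ^ r"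
proof -
  have "(\<Prod>i<Suc (Suc r). card {d \<in> square4. overlap (block_types 0 i) 0 d \<noteq> 0}) = 13 * (13 * 9 ^ r)"
    "(\<Prod>i<Suc (Suc r). card {d \<in> square4. overlap (block_types 0 i) 1 d \<noteq> 0}) = 10 * (13 * 9 ^ r)"
    using card_overlap_support by (simp_all only: prod.lessThan_Suc_shift) (simp_all add: block_types_def)
  then show ?thesis
    unfolding diff_count_dual_T by (simp only:)
qed

lemma family_count_less:
  assumes "j < k" "k \<le> m"
  shows "9 ^ (m - j) * (13 ^ j + 10 ^ j) < (9 ^ (m - k) * (13 ^ k + 10 ^ k) :: nat)"
  using assms(1,2)
proof (induction rule: strict_inc_induct)
  case (base i)
  then have "m - i = Suc (m - k)" by simp
  then have "9 ^ (m - i) * (13 ^ i + 10 ^ i) = (9 ^ (m - k) * (9 * (13 ^ i + 10 ^ i)) :: nat)" by simp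
  also have "\<dots> < 9 ^ (m - k) * (13 ^ k + 10 ^ k)" using base by (simp add: base)
  finally show ?case .
next
  case (step i)
  then have "m - i = Suc (m - Suc i)" by simp
  then have "9 ^ (m - i) * (13 ^ i + 10 ^ i) = (9 ^ (m - Suc i) * (9 * (13 ^ i + 10 ^ i)) :: nat)" by simp
  also have "\<dots> < 9 ^ (m - Suc i) * (13 ^ Suc i + 10 ^ Suc i)" by simp
  also have "\<dots> < 9 ^ (m - k) * (13 ^ k + 10 ^ k)" using step by simp
  finally show ?case .
qed

text \<open>The left-hand side is divisible by 13, since \<open>299 = 13 * 23\<close>, and the right-hand side is not.\<close>
lemma family_count_ne:
  assumes "0 < k" "k \<le> Suc (Suc r)"
  shows "299 * 9 ^ r \<noteq> (9 ^ (Suc (Suc r) - k) * (13 ^ k + 10 ^ k) :: nat)"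
proof
  assume eq: "299 * 9 ^ r = (9 ^ (Suc (Suc r) - k) * (13 ^ k + 10 ^ k) :: nat)"
  have p: "Factorial_Ring.prime (13 :: nat)" by simp
  have "13 dvd 299 * (9 :: nat) ^ r" by simp
  then have "13 dvd (9 ^ (Suc (Suc r) - k) * (13 ^ k + 10 ^ k) :: nat)" unfolding eq .
  moreover have "\<not> 13 dvd (9 :: nat) ^ (Suc (Suc r) - k)"
    using Factorial_Ring.prime_dvd_power[OF p, of 9] by auto
  ultimately have "13 dvd (13 ^ k + 10 ^ k :: nat)"
    using Factorial_Ring.prime_dvd_mult_iff[OF p] by blast
  moreover have "13 dvd (13 ^ k :: nat)" using assms(1) by simp
  ultimately have "13 dvd (10 ^ k :: nat)" using dvd_add_right_iff by blast
  then show False using Factorial_Ring.prime_dvd_power[OF p, of 10] by auto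
qed

lemma diff_count_family_inj:
  assumes "2 \<le> m"
  shows "inj_on (\<lambda>k. diff_count (Z2_Z4_power (2 * m)) (dual_T m (block_types k))) {..m}"
proof -
  obtain r where r: "m = Suc (Suc r)" using assms by (metis add_2_eq_Suc le_Suc_ex)
  let ?D = "\<lambda>k. diff_count (Z2_Z4_power (2 * m)) (dual_T m (block_types k))"
  have "?D j \<noteq> ?D k" if "j < k" "k \<le> m" for j k
  proof (cases "j = 0")
    case True
    then show ?thesis
      using family_count_ne[of k r] diff_count_family[of k m] diff_count_family_0[of r] that r by simp
  next
    case False
    then show ?thesis
      using family_count_less[OF that] diff_count_family[of k m] diff_count_family[of j m] that by simp
  qed
  then show ?thesis by (intro linorder_inj_onI') auto
qed

theorem theorem6p7:
  fixes m :: nat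
  assumes "m \<ge> 2"
  shows "\<exists>P :: ((int \<times> (nat \<Rightarrow> int)) set \<times> (int \<times> (nat \<Rightarrow> int)) set) set.
           finite P \<and> card P \<ge> m + 1 \<and>
           (\<forall>(S, T) \<in> P. primitive_formally_dual_pair (Z2_Z4_power (2 * m)) S T) \<and>
           pairwise (\<lambda>p q. \<not> equivalent_pairs (Z2_Z4_power (2 * m)) p q) P"
proof -
  let ?G = "Z2_Z4_power (2 * m)"
  define p where "p k = (dual_S m (block_types k), dual_T m (block_types k))" for k
  have inj_count: "inj_on (\<lambda>k. diff_count ?G (dual_T m (block_types k))) {..m}"
    using assms by (rule diff_count_family_inj)
  have "inj_on p {..m}"
    by (rule inj_onI, rule inj_onD[OF inj_count]) (auto simp: p_def)
  then have "card (p ` {..m}) = m + 1" by (simp add: card_image)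
  moreover have "primitive_formally_dual_pair ?G (dual_S m (block_types k)) (dual_T m (block_types k))" for k
  proof -
    have "block_types k 0 = Bent" by (simp add: block_types_def)
    then show ?thesis
      using assms by (simp add: primitive_formally_dual_pair_def formally_dual_pair_dual
          primitive_dual_S primitive_dual_T)
  qed
  moreover have "\<not> equivalent_pairs ?G (p j) (p k)" if "j \<le> m" "k \<le> m" "p j \<noteq> p k" for j k
    unfolding p_def
  proof (rule not_equivalent_pairs[OF comm_group_Z2_Z4_power finite_Z2_Z4_power])
    show "diff_count ?G (dual_T m (block_types j)) \<noteq> diff_count ?G (dual_T m (block_types k))"
      using that inj_onD[OF inj_count, of j k] by auto
  qed (simp_all add: formally_dual_pair_dual card_dual_S card_dual_T)
  ultimately show ?thesis
    by (intro exI[of _ "p ` {..m}"]) (auto simp: pairwise_def p_def)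
qed

end
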